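(* The projective unknot is a companion of every knot $K$ in $\mathbb{R}P^3$.
   Context: A knot in $\mathbb{R}P^3$ is a (smooth, tame) embedding of $S^1$ in $\mathbb{R}P^3$, considered up to ambient isotopy. The projective unknot is the knot type of a projective line in $\mathbb{R}P^3$ (equivalently, the class of knots that are homotopically non-trivial and admit a diagram without crossings on a projective plane). A subset of a solid torus is geometrically essential if every meridional disk of the solid torus intersects it. A knot $K_1$ in $\mathbb{R}P^3$ is a companion of a knot $K_2$ if there exists a tubular neighborhood $V$ of $K_1$ containing $K_2$ such that $K_2$ is geometrically essential in $V$ (knots being taken up to ambient isotopy). *)

theory Defs
  imports "HOL-Analysis.Analysis"
begin

section \<open>Smooth maps between subsets of Euclidean spaces\<close>

text \<open>
  The predicate \<open>Ck_on k f U\<close> is meant for open \<open>U\<close>: all iterated directional derivatives of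
  \<open>f\<close> of order at most \<open>k\<close> exist and are continuous on \<open>U\<close>.
\<close>

primrec Ck_on :: "nat \<Rightarrow> ('a::euclidean_space \<Rightarrow> 'b::euclidean_space) \<Rightarrow> 'a set \<Rightarrow> bool" where
  "Ck_on 0 f U \<longleftrightarrow> continuous_on U f"
| "Ck_on (Suc k) f U \<longleftrightarrow>
     (\<forall>x\<in>U. f differentiable (at x)) \<and>
     (\<forall>v. Ck_on k (\<lambda>x. frechet_derivative f (at x) v) U)"

text \<open>
  Smoothness on an arbitrary subset of a Euclidean space, as in Milnor's ``Topology from the
  Differentiable Viewpoint'': the map extends, near each point of the set, to a smooth map on
  an open set.  On submanifolds of Euclidean space, with or without boundary, this is the usual
  notion, and a smooth embedding of a compact manifold is a diffeomorphism onto its image.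
\<close>

definition smooth_on :: "'a::euclidean_space set \<Rightarrow> ('a \<Rightarrow> 'b::euclidean_space) \<Rightarrow> bool" where
  "smooth_on S f \<longleftrightarrow>
     (\<forall>x\<in>S. \<exists>U F. open U \<and> x \<in> U \<and> (\<forall>k. Ck_on k F U) \<and> (\<forall>y\<in>U \<inter> S. F y = f y))"

definition diffeomorphism ::
    "'a::euclidean_space set \<Rightarrow> 'b::euclidean_space set \<Rightarrow> ('a \<Rightarrow> 'b) \<Rightarrow> bool" where
  "diffeomorphism S T f \<longleftrightarrow> bij_betw f S T \<and> smooth_on S f \<and> smooth_on T (inv_into S f)"

definition smooth_embedding ::
    "'a::euclidean_space set \<Rightarrow> 'b::euclidean_space set \<Rightarrow> ('a \<Rightarrow> 'b) \<Rightarrow> bool" where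
  "smooth_embedding S T f \<longleftrightarrow> f ` S \<subseteq> T \<and> diffeomorphism S (f ` S) f"


section \<open>Real projective 3-space\<close>

text \<open>
  Projective 3-space is the quotient of the unit sphere of \<open>real^4\<close> by the antipodal map,
  realised as a smooth submanifold of the Euclidean space of 4 by 4 matrices: the point with
  homogeneous coordinates \<open>x\<close>, where \<open>norm x = 1\<close>, is the matrix \<open>x x\<^sup>T\<close> of the orthogonal
  projection onto the line spanned by \<open>x\<close> (the Veronese embedding).  The map \<open>proj_pt\<close> is a
  polynomial immersion of the sphere, and its fibres are the antipodal pairs.
\<close>

definition proj_pt :: "real^4 \<Rightarrow> real^4^4" where
  "proj_pt x = (\<chi> i j. x $ i * x $ j)"

definition RP3 :: "(real^4^4) set" where
  "RP3 = proj_pt ` sphere 0 1"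

lemma proj_pt_eq_iff: "proj_pt x = proj_pt y \<longleftrightarrow> x = y \<or> x = - y"
proof
  assume "proj_pt x = proj_pt y"
  then have eq: "x $ i * x $ j = y $ i * y $ j" for i j
    by (simp add: proj_pt_def vec_eq_iff)
  show "x = y \<or> x = - y"
  proof (cases "x = 0")
    case True
    then have "y $ i = 0" for i
      using eq[of i i] by simp
    then show ?thesis
      using True by (simp add: vec_eq_iff)
  next
    case False
    then obtain i where i: "x $ i \<noteq> 0"
      by (auto simp: vec_eq_iff)
    from eq[of i i] have "x $ i = y $ i \<or> x $ i = - y $ i"
      by (simp add: square_eq_iff)
    then show ?thesis
    proof
      assume "x $ i = y $ i"
      then have "x $ j = y $ j" for j
        using eq[of i j] i by auto
      then show ?thesis by (simp add: vec_eq_iff)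
    next
      assume neg: "x $ i = - y $ i"
      have "x $ j = - y $ j" for j
      proof -
        have "x $ i * x $ j = x $ i * (- y $ j)"
          using eq[of i j] neg by simp
        then show ?thesis using i by (metis mult_left_cancel)
      qed
      then show ?thesis by (simp add: vec_eq_iff)
    qed
  qed
qed (auto simp: proj_pt_def vec_eq_iff)

definition projective_line :: "(real^4^4) set \<Rightarrow> bool" where
  "projective_line L \<longleftrightarrow>
     (\<exists>W :: (real^4) set. subspace W \<and> dim W = 2 \<and> L = proj_pt ` (W \<inter> sphere 0 1))"


section \<open>Knots up to ambient isotopy\<close>

text \<open>Knots are unoriented and identified with their images.\<close>

definition knot :: "(real^4^4) set \<Rightarrow> bool" where
  "knot K \<longleftrightarrow>
     (\<exists>f :: complex \<Rightarrow> real^4^4. smooth_embedding (sphere 0 1) RP3 f \<and> K = f ` sphere 0 1)"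

text \<open>
  An ambient isotopy is given by its level-preserving track; in particular every \<open>H t\<close> with
  \<open>t\<close> in the unit interval is a diffeomorphism of projective space.
\<close>

definition ambient_isotopic :: "(real^4^4) set \<Rightarrow> (real^4^4) set \<Rightarrow> bool" where
  "ambient_isotopic K K' \<longleftrightarrow>
     (\<exists>H :: real \<Rightarrow> real^4^4 \<Rightarrow> real^4^4.
        diffeomorphism ({0..1} \<times> RP3) ({0..1} \<times> RP3) (\<lambda>(t, A). (t, H t A)) \<and>
        (\<forall>A\<in>RP3. H 0 A = A) \<and>
        H 1 ` K = K')"

definition projective_unknot :: "(real^4^4) set set" where
  "projective_unknot = {K. knot K \<and> (\<exists>L. projective_line L \<and> ambient_isotopic L K)}"


section \<open>Solid tori and companions\<close>

definition std_solid_torus :: "(complex \<times> complex) set" where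
  "std_solid_torus = sphere 0 1 \<times> cball 0 1"

definition framing :: "(real^4^4) set \<Rightarrow> (complex \<times> complex \<Rightarrow> real^4^4) \<Rightarrow> bool" where
  "framing V \<phi> \<longleftrightarrow> V \<subseteq> RP3 \<and> diffeomorphism std_solid_torus V \<phi>"

text \<open>
  A tubular neighborhood is a closed one.  Since projective 3-space is orientable, the normal
  disk bundle of a knot is trivial, so its total space is \<^const>\<open>std_solid_torus\<close>.
\<close>

definition tubular_neighborhood :: "(real^4^4) set \<Rightarrow> (real^4^4) set \<Rightarrow> bool" where
  "tubular_neighborhood V K \<longleftrightarrow> (\<exists>\<phi>. framing V \<phi> \<and> \<phi> ` (sphere 0 1 \<times> {0}) = K)"

text \<open>
  A meridional disk is a properly embedded disk whose boundary is a meridian.  As in Rolfsen's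
  ``Knots and Links'', a meridian of \<open>V\<close> is a curve that is \<open>{p} \<times> S\<^sup>1\<close> for some framing of \<open>V\<close>.
\<close>

definition meridian :: "(real^4^4) set \<Rightarrow> (real^4^4) set \<Rightarrow> bool" where
  "meridian V J \<longleftrightarrow> (\<exists>\<phi> p. framing V \<phi> \<and> p \<in> sphere 0 1 \<and> J = \<phi> ` ({p} \<times> sphere 0 1))"

text \<open>The boundary torus does not depend on the framing, by invariance of domain.\<close>

definition torus_boundary :: "(real^4^4) set \<Rightarrow> (real^4^4) set" where
  "torus_boundary V = {x. \<exists>\<phi>. framing V \<phi> \<and> x \<in> \<phi> ` (sphere 0 1 \<times> sphere 0 1)}"

definition meridional_disk :: "(real^4^4) set \<Rightarrow> (real^4^4) set \<Rightarrow> bool" where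
  "meridional_disk V D \<longleftrightarrow>
     (\<exists>g :: complex \<Rightarrow> real^4^4.
        smooth_embedding (cball 0 1) V g \<and> D = g ` cball 0 1 \<and>
        D \<inter> torus_boundary V = g ` sphere 0 1 \<and> meridian V (g ` sphere 0 1))"

definition geometrically_essential :: "(real^4^4) set \<Rightarrow> (real^4^4) set \<Rightarrow> bool" where
  "geometrically_essential V X \<longleftrightarrow> (\<forall>D. meridional_disk V D \<longrightarrow> D \<inter> X \<noteq> {})"

definition companion :: "(real^4^4) set \<Rightarrow> (real^4^4) set \<Rightarrow> bool" where
  "companion K1 K2 \<longleftrightarrow>
     (\<exists>K1' K2' V. ambient_isotopic K1 K1' \<and> ambient_isotopic K2 K2' \<and>
        tubular_neighborhood V K1' \<and> K2' \<subseteq> V \<and> geometrically_essential V K2')"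

end

theory Submission
  imports Defs
begin

text \<open>
  The knot itself need not be moved: only the projective line is chosen.  If a line \<open>Z\<close> misses \<open>K\<close>,
  then \<open>K\<close> lies in a large tubular neighborhood \<open>V\<close> of a line complementary to \<open>Z\<close>, and its winding
  number in \<open>V\<close> is that of \<open>u\<^sup>2\<close> along \<open>K\<close>, where \<open>u\<close> is a complex-valued real-linear form with
  kernel \<open>Z\<close>.  A generic line through a generic point \<open>x\<^sub>0\<close> of \<open>K\<close> meets \<open>K\<close> only in \<open>x\<^sub>0\<close>
  and is not tangent to it.  Pushing this line off \<open>K\<close> to the two sides gives two
  winding numbers that differ by 2, so one of the two lines has a nonzero winding number.
  A nonzero winding number makes \<open>K\<close> geometrically essential: in the universal cover
  \<open>\<real> \<times> D\<^sup>2\<close> of \<open>V\<close>, a lifted meridional disk cannot avoid a path going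
  from one end to the other, which is an instance of Brouwer's fixed point theorem.  Finally, all
  projective lines are ambient isotopic, by shears of \<open>\<real>\<^sup>4\<close>.
\<close>

section \<open>Smooth maps and ambient isotopies\<close>

text \<open>Homogeneous coordinates of a point of the knot are determined only up to sign, so
  \<open>u\<close> is not a function on the knot, while \<open>u\<^sup>2\<close> and the ratio of
  two such forms are. The two winding numbers are compared through the ratio of the two pushed
  forms: along one period it meets the closed negative half-axis only at \<open>x\<^sub>0\<close>,
  where it equals -1 and changes sides. So it winds once, and its square twice. If both squared
  forms had continuous arguments on the circle, their difference would be an argument of the squared
  ratio. One of the two winding numbers may well be 0; neither is computed, and "nonzero winding
  number" is expressed throughout as the absence of a continuous argument. On the side of the solid
  torus the obstacle is that a meridian comes with an unknown framing. All that is known about the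
  change of framing is that it is a homeomorphism respecting interior and boundary; this still
  determines the degree of the disk coordinate along the meridian up to sign, which is what the
  fixed point argument needs.\<close>

lemma Ck_on_cong:
  assumes "open U" "\<And>x. x \<in> U \<Longrightarrow> f x = g x" "Ck_on k f U"
  shows "Ck_on k g U"
  using assms(2,3)
proof (induction k arbitrary: f g)
  case 0
  then show ?case by (simp cong: continuous_on_cong)
next
  case (Suc k)
  have d: "(f has_derivative f') (at x) \<longleftrightarrow> (g has_derivative f') (at x)" if "x \<in> U" for x f'
    using has_derivative_transform_within_open[OF _ assms(1) that, of f f' UNIV g]
      has_derivative_transform_within_open[OF _ assms(1) that, of g f' UNIV f] Suc.prems(1) by auto
  have fd: "frechet_derivative f (at x) = frechet_derivative g (at x)" if "x \<in> U" for x
    unfolding frechet_derivative_def using d[OF that] by simp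
  show ?case
    using Suc.prems(2) d fd Suc.IH[of "\<lambda>x. frechet_derivative f (at x) v" "\<lambda>x. frechet_derivative g (at x) v" for v]
    by (auto simp: differentiable_def)
qed

text \<open>Most closure properties below are inductions on the order; this turns their step into a
  formula for the derivative and frees it from \<open>frechet_derivative\<close>.\<close>

lemma Ck_onI_Suc:
  assumes "open U" "\<And>x. x \<in> U \<Longrightarrow> (f has_derivative f' x) (at x)" "\<And>v. Ck_on k (\<lambda>x. f' x v) U"
  shows "Ck_on (Suc k) f U"
proof -
  have "frechet_derivative f (at x) = f' x" if "x \<in> U" for x
    using frechet_derivative_at[OF assms(2)[OF that]] by simp
  then have "Ck_on k (\<lambda>x. frechet_derivative f (at x) v) U" for v
    using Ck_on_cong[OF assms(1) _ assms(3)[of v]] by simp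
  then show ?thesis using assms(2) by (auto simp: differentiable_def)
qed

lemma Ck_on_mono_open: "Ck_on k f U \<Longrightarrow> V \<subseteq> U \<Longrightarrow> Ck_on k f V"
  by (induction k arbitrary: f) (auto intro: continuous_on_subset)

text \<open>Product and chain rule keep undifferentiated factors, whose regularity of order
  \<open>k\<close> the induction steps have to supply.\<close>

lemma Ck_on_Suc_imp: "Ck_on (Suc k) f U \<Longrightarrow> Ck_on k f U"
proof (induction k arbitrary: f)
  case 0
  then show ?case
    by (auto simp: continuous_on_eq_continuous_within intro!: differentiable_imp_continuous_within
        intro: differentiable_at_withinI)
next
  case (Suc k)
  from Suc.prems have "f differentiable (at x)" if "x \<in> U" for x using that by simp
  moreover have "Ck_on (Suc k) (\<lambda>x. frechet_derivative f (at x) v) U" for v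
    using Suc.prems by (simp only: Ck_on.simps(2)[of "Suc k"])
  ultimately show ?case using Suc.IH by simp
qed

lemma Ck_on_imp_continuous: "Ck_on k f U \<Longrightarrow> continuous_on U f"
proof (induction k)
  case (Suc k) then show ?case using Ck_on_Suc_imp by blast
qed simp

lemma Ck_on_has_derivative:
  "Ck_on (Suc k) f U \<Longrightarrow> x \<in> U \<Longrightarrow> (f has_derivative frechet_derivative f (at x)) (at x)"
  by (simp add: frechet_derivative_works)

lemma Ck_on_const: "open U \<Longrightarrow> Ck_on k (\<lambda>x. c) U"
proof (induction k arbitrary: c)
  case (Suc k)
  show ?case by (rule Ck_onI_Suc[OF Suc.prems has_derivative_const Suc.IH[OF Suc.prems]])
qed simp

lemma Ck_on_linear:
  assumes "open U" "bounded_linear L" shows "Ck_on k L U"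
proof (cases k)
  case 0
  then show ?thesis using assms by (simp add: linear_continuous_on)
next
  case (Suc j)
  show ?thesis unfolding Suc
    using bounded_linear_imp_has_derivative[OF assms(2)]
    by (intro Ck_onI_Suc[OF assms(1), of _ "\<lambda>x. L"] Ck_on_const assms(1)) auto
qed

lemma Ck_on_add:
  assumes "open U" "Ck_on k f U" "Ck_on k g U" shows "Ck_on k (\<lambda>x. f x + g x) U"
  using assms(2,3)
proof (induction k arbitrary: f g)
  case 0 then show ?case by (auto intro: continuous_intros)
next
  case (Suc k)
  show ?case
    by (rule Ck_onI_Suc[OF assms(1) has_derivative_add[OF Ck_on_has_derivative Ck_on_has_derivative]])
       (use Suc in \<open>auto intro!: Suc.IH\<close>)
qed

lemma Ck_on_sum:
  assumes "open U" "finite I" "\<And>i. i \<in> I \<Longrightarrow> Ck_on k (f i) U"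
  shows "Ck_on k (\<lambda>x. \<Sum>i\<in>I. f i x) U"
  using assms(2,3) by (induction I rule: finite_induct) (auto intro: Ck_on_const Ck_on_add assms(1))

lemma Ck_on_bilinear:
  assumes "open U" "bounded_bilinear B" "Ck_on k f U" "Ck_on k g U"
  shows "Ck_on k (\<lambda>x. B (f x) (g x)) U"
  using assms(3,4)
proof (induction k arbitrary: f g)
  case 0 then show ?case using bounded_bilinear.continuous_on[OF assms(2)] by auto
next
  case (Suc k)
  have *: "Ck_on k f U" "Ck_on k g U" using Suc.prems Ck_on_Suc_imp by blast+
  show ?case
    by (rule Ck_onI_Suc[OF assms(1) bounded_bilinear.FDERIV[OF assms(2) Ck_on_has_derivative Ck_on_has_derivative]])
       (use Suc * in \<open>auto intro!: Suc.IH Ck_on_add assms(1)\<close>)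
qed

lemma Ck_on_linear_comp:
  assumes "open U" "bounded_linear L" "Ck_on k f U" shows "Ck_on k (\<lambda>x. L (f x)) U"
  using assms(3)
proof (induction k arbitrary: f)
  case 0 then show ?case using bounded_linear.continuous_on[OF assms(2)] by auto
next
  case (Suc k)
  show ?case
    by (rule Ck_onI_Suc[OF assms(1) bounded_linear.has_derivative[OF assms(2) Ck_on_has_derivative]])
       (use Suc in \<open>auto intro!: Suc.IH\<close>)
qed

lemma Ck_on_compose:
  fixes f :: "'a::euclidean_space \<Rightarrow> 'b::euclidean_space" and g :: "'b \<Rightarrow> 'c::euclidean_space"
  assumes "open U" "open V" "f ` U \<subseteq> V" "Ck_on k f U" "Ck_on k g V"
  shows "Ck_on k (\<lambda>x. g (f x)) U"
  using assms(4,5)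
proof (induction k arbitrary: g)
  case 0 then show ?case using assms(3) by (auto intro: continuous_on_compose2)
next
  case (Suc k)
  let ?F = "\<lambda>x. frechet_derivative f (at x)" and ?G = "\<lambda>x. frechet_derivative g (at x)"
  have f: "Ck_on k f U" using Suc.prems Ck_on_Suc_imp by blast
  have fd: "(f has_derivative ?F x) (at x)" if "x \<in> U" for x
    using Ck_on_has_derivative Suc.prems(1) that by blast
  have gd: "(g has_derivative ?G (f x)) (at (f x))" if "x \<in> U" for x
    using Ck_on_has_derivative Suc.prems(2) that assms(3) by blast
  \<comment> \<open>The direction \<open>?F x v\<close> moves with \<open>x\<close>, whereas
    \<open>Ck_on\<close> speaks of fixed directions. Expanded in the basis, only
    \<open>?G (f x) b\<close> remains, and the induction hypothesis applies to the directional
    derivative of \<open>g\<close> along \<open>b\<close>.\<close>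
  have eq: "?G (f x) (?F x v) = (\<Sum>b\<in>Basis. (?F x v \<bullet> b) *\<^sub>R ?G (f x) b)" if "x \<in> U" for x v
  proof -
    interpret linear "?G (f x)" using gd[OF that] has_derivative_linear by blast
    have "?G (f x) (?F x v) = ?G (f x) (\<Sum>b\<in>Basis. (?F x v \<bullet> b) *\<^sub>R b)"
      by (simp add: euclidean_representation)
    then show ?thesis by (simp add: sum scale)
  qed
  have "Ck_on k (\<lambda>x. \<Sum>b\<in>Basis. (?F x v \<bullet> b) *\<^sub>R ?G (f x) b) U" for v
    using Suc.prems
    by (intro Ck_on_sum Ck_on_bilinear[OF _ bounded_bilinear_scaleR] Suc.IH
          Ck_on_linear_comp[OF _ bounded_linear_inner_left] assms(1) f) auto
  then have "Ck_on k (\<lambda>x. ?G (f x) (?F x v)) U" for v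
    by (rule Ck_on_cong[OF assms(1), rotated]) (simp add: eq)
  moreover have "((\<lambda>x. g (f x)) has_derivative (\<lambda>v. ?G (f x) (?F x v))) (at x)" if "x \<in> U" for x
    using has_derivative_compose[OF fd[OF that] gd[OF that]] .
  ultimately show ?case by (rule Ck_onI_Suc[OF assms(1), rotated])
qed

lemma Ck_on_inverse:
  fixes f :: "'a::euclidean_space \<Rightarrow> real"
  assumes "open U" "Ck_on k f U" "\<And>x. x \<in> U \<Longrightarrow> f x \<noteq> 0"
  shows "Ck_on k (\<lambda>x. inverse (f x)) U"
  using assms(2)
proof (induction k)
  case 0 then show ?case using assms(3) by (auto intro: continuous_intros)
next
  case (Suc k)
  have *: "Ck_on k (\<lambda>x. inverse (f x)) U" using Suc Ck_on_Suc_imp by blast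
  have "Ck_on k (\<lambda>x. - (inverse (f x) * frechet_derivative f (at x) v * inverse (f x))) U" for v
    using Suc.prems
    by (intro Ck_on_linear_comp[OF _ bounded_linear_minus[OF bounded_linear_ident]]
        Ck_on_bilinear[OF _ bounded_bilinear_mult] * assms(1)) auto
  then show ?case
    by (rule Ck_onI_Suc[OF assms(1), rotated])
      (rule Deriv.has_derivative_inverse[OF assms(3) Ck_on_has_derivative[OF Suc.prems]])
qed

lemma Ck_on_Pair:
  assumes "open U" "Ck_on k f U" "Ck_on k g U" shows "Ck_on k (\<lambda>x. (f x, g x)) U"
  using assms(2,3)
proof (induction k arbitrary: f g)
  case 0 then show ?case by (auto intro: continuous_intros)
next
  case (Suc k)
  show ?case
    by (rule Ck_onI_Suc[OF assms(1) has_derivative_Pair[OF Ck_on_has_derivative Ck_on_has_derivative]])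
       (use Suc in \<open>auto intro!: Suc.IH\<close>)
qed

lemma Ck_on_vec:
  fixes f :: "'a::euclidean_space \<Rightarrow> 'b::euclidean_space ^ 'n"
  assumes "open U" "\<And>i. Ck_on k (\<lambda>x. f x $ i) U" shows "Ck_on k f U"
proof -
  have L: "bounded_linear (axis i :: 'b \<Rightarrow> 'b^'n)" for i
    by (auto simp: linear_conv_bounded_linear[symmetric] axis_def vec_eq_iff intro!: linearI)
  have "f x = (\<Sum>i\<in>UNIV. axis i (f x $ i))" for x
    by (simp add: vec_eq_iff axis_def if_distrib[of "\<lambda>h. h $ _"] sum.delta cong: if_cong)
  moreover have "Ck_on k (\<lambda>x. \<Sum>i\<in>UNIV. axis i (f x $ i) :: 'b^'n) U"
    by (intro Ck_on_sum Ck_on_linear_comp[OF _ L] assms) auto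
  ultimately show ?thesis by simp
qed

section \<open>Smoothness on arbitrary subsets\<close>

lemma smooth_onI:
  assumes "open U" "S \<subseteq> U" "\<And>k. Ck_on k F U" "\<And>x. x \<in> S \<Longrightarrow> F x = f x"
  shows "smooth_on S f"
  unfolding smooth_on_def using assms by (intro ballI exI[of _ U] exI[of _ F]) auto

lemma smooth_onE:
  assumes "smooth_on S f" "x \<in> S"
  obtains U F where "open U" "x \<in> U" "\<forall>k. Ck_on k F U" "\<forall>y\<in>U \<inter> S. F y = f y"
proof -
  have "\<exists>U F. open U \<and> x \<in> U \<and> (\<forall>k. Ck_on k F U) \<and> (\<forall>y\<in>U \<inter> S. F y = f y)"
    using assms unfolding smooth_on_def by (rule bspec)
  then show thesis
    by (elim exE conjE) (rule that)
qed

lemma smooth_on_cong: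
  assumes "smooth_on S f" "\<And>x. x \<in> S \<Longrightarrow> f x = g x" shows "smooth_on S g"
  unfolding smooth_on_def
proof
  fix x assume x: "x \<in> S"
  obtain U F where "open U" "x \<in> U" "\<forall>k. Ck_on k F U" "\<forall>y\<in>U \<inter> S. F y = f y"
    by (rule smooth_onE[OF assms(1) x])
  then show "\<exists>U F. open U \<and> x \<in> U \<and> (\<forall>k. Ck_on k F U) \<and> (\<forall>y\<in>U \<inter> S. F y = g y)"
    using assms(2) by (intro exI[of _ U] exI[of _ F]) simp
qed

lemma smooth_on_imp_continuous_on:
  assumes "smooth_on S f" shows "continuous_on S f"
  unfolding continuous_on_eq_continuous_within
proof
  fix x assume "x \<in> S"
  obtain U F where U: "open U" "x \<in> U" "\<forall>k. Ck_on k F U" "\<forall>y\<in>U \<inter> S. F y = f y"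
    by (rule smooth_onE[OF assms \<open>x \<in> S\<close>])
  have "isCont F x"
    using Ck_on_imp_continuous[OF U(3)[rule_format, of 0]] U(1,2) by (simp add: continuous_on_eq_continuous_at)
  then have "continuous (at x within S) F" by (rule continuous_at_imp_continuous_within)
  moreover have "\<forall>\<^sub>F y in at x within S. F y = f y"
    unfolding eventually_at_topological using U(1,2,4) by (intro exI[of _ U]) simp
  moreover have "F x = f x" using U(2,4) \<open>x \<in> S\<close> by simp
  ultimately show "continuous (at x within S) f"
    unfolding continuous_within by (simp add: tendsto_cong[of F f])
qed

lemma smooth_on_compose:
  fixes f :: "'a::euclidean_space \<Rightarrow> 'b::euclidean_space" and g :: "'b \<Rightarrow> 'c::euclidean_space"
  assumes "smooth_on S f" "smooth_on T g" "f ` S \<subseteq> T"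
  shows "smooth_on S (\<lambda>x. g (f x))"
  unfolding smooth_on_def
proof
  fix x assume x: "x \<in> S"
  obtain U F where U: "open U" "x \<in> U" "\<forall>k. Ck_on k F U" "\<forall>y\<in>U \<inter> S. F y = f y"
    by (rule smooth_onE[OF assms(1) x])
  have "f x \<in> T" using assms(3) x by blast
  obtain V G where V: "open V" "f x \<in> V" "\<forall>k. Ck_on k G V" "\<forall>y\<in>V \<inter> T. G y = g y"
    by (rule smooth_onE[OF assms(2) \<open>f x \<in> T\<close>])
  define W where "W = U \<inter> F -` V"
  have W: "open W"
    unfolding W_def
    by (rule continuous_open_preimage[OF Ck_on_imp_continuous[OF U(3)[rule_format, of 0]] U(1) V(1)])
  have k: "Ck_on k (\<lambda>x. G (F x)) W" for k
  proof (rule Ck_on_compose[OF W V(1)])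
    show "F ` W \<subseteq> V" unfolding W_def by blast
    show "Ck_on k F W" by (rule Ck_on_mono_open[OF U(3)[rule_format]]) (simp add: W_def)
    show "Ck_on k G V" by (rule V(3)[rule_format])
  qed
  have eq: "F y = f y" if "y \<in> U \<inter> S" for y using U(4) that by blast
  have "G (F y) = g (f y)" if "y \<in> W \<inter> S" for y
  proof -
    have "F y = f y" using eq that W_def by blast
    moreover have "f y \<in> V \<inter> T" using calculation that assms(3) W_def by fastforce
    ultimately show ?thesis using V(4) by simp
  qed
  moreover have "x \<in> W" using U(2) V(2) eq[of x] x by (simp add: W_def)
  ultimately show "\<exists>U H. open U \<and> x \<in> U \<and> (\<forall>k. Ck_on k H U) \<and> (\<forall>y\<in>U \<inter> S. H y = g (f y))"
    using W k by (intro exI[of _ W] exI[of _ "\<lambda>x. G (F x)"] conjI allI ballI)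
qed

section \<open>Diffeomorphisms and the equivalence properties of ambient isotopy\<close>

lemma diffeomorphismI:
  assumes "smooth_on S f" "smooth_on T g" "\<And>x. x \<in> S \<Longrightarrow> f x \<in> T \<and> g (f x) = x"
    "\<And>y. y \<in> T \<Longrightarrow> g y \<in> S \<and> f (g y) = y"
  shows "diffeomorphism S T f"
  unfolding diffeomorphism_def
proof (intro conjI)
  show b: "bij_betw f S T" by (rule bij_betw_byWitness[of _ g]) (use assms in auto)
  show "smooth_on T (inv_into S f)"
    by (rule smooth_on_cong[OF assms(2)]) (metis assms(3,4) b bij_betw_imp_inj_on inv_into_f_f)
qed (rule assms)

lemma diffeomorphism_comp:
  fixes f :: "'a::euclidean_space \<Rightarrow> 'b::euclidean_space" and g :: "'b \<Rightarrow> 'c::euclidean_space"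
  assumes f: "diffeomorphism S T f" and g: "diffeomorphism T R g"
  shows "diffeomorphism S R (\<lambda>x. g (f x))"
proof (rule diffeomorphismI[where g = "\<lambda>y. inv_into S f (inv_into T g y)"])
  have b: "bij_betw f S T" "bij_betw g T R" and s: "smooth_on S f" "smooth_on T g"
      "smooth_on T (inv_into S f)" "smooth_on R (inv_into T g)"
    using f g unfolding diffeomorphism_def by auto
  have im: "f ` S = T" "g ` T = R" "inv_into T g ` R = T"
    using b bij_betw_inv_into[of g T R] by (auto simp: bij_betw_def)
  show "smooth_on S (\<lambda>x. g (f x))"
    by (rule smooth_on_compose[OF s(1,2)]) (simp add: im)
  show "smooth_on R (\<lambda>y. inv_into S f (inv_into T g y))"
    by (rule smooth_on_compose[OF s(4,3)]) (simp add: im)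
  show "g (f x) \<in> R \<and> inv_into S f (inv_into T g (g (f x))) = x" if "x \<in> S" for x
    using that b im by (metis bij_betw_inv_into_left imageI)
  show "inv_into S f (inv_into T g y) \<in> S \<and> g (f (inv_into S f (inv_into T g y))) = y" if "y \<in> R" for y
    using that b im by (metis bij_betw_inv_into_right imageI inv_into_into)
qed

text \<open>The inverse of the track is again level-preserving, so its smoothness is joint
  smoothness of the inverses of all levels. \<open>K \<subseteq> RP3\<close> enters because nothing
  is known about \<open>H 1\<close> off \<open>RP3\<close>.\<close>

lemma ambient_isotopic_sym:
  assumes "ambient_isotopic K K'" and K: "K \<subseteq> RP3" shows "ambient_isotopic K' K"
proof -
  obtain H where H: "diffeomorphism ({0..1} \<times> RP3) ({0..1} \<times> RP3) (\<lambda>(t::real, A). (t, H t A))"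
    "\<forall>A\<in>RP3. H 0 A = A" "H 1 ` K = K'"
    using assms(1) unfolding ambient_isotopic_def by (elim exE conjE)
  let ?I = "{0..1::real} \<times> RP3" and ?\<Phi> = "\<lambda>(t::real, A). (t, H t A)"
  define G where "G t A = snd (inv_into ?I ?\<Phi> (t, A))" for t A
  have b: "bij_betw ?\<Phi> ?I ?I" using H(1) unfolding diffeomorphism_def by blast
  have G: "inv_into ?I ?\<Phi> (t, A) = (t, G t A)" if "(t, A) \<in> ?I" for t A
  proof -
    have "?\<Phi> (inv_into ?I ?\<Phi> (t, A)) = (t, A)" using b bij_betw_inv_into_right that by meson
    then show ?thesis unfolding G_def by (auto split: prod.splits)
  qed
  have GH: "G t (H t A) = A" if "t \<in> {0..1}" "A \<in> RP3" for t A
    using bij_betw_inv_into_left[OF b, of "(t, A)"] that unfolding G_def by auto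
  have smo: "smooth_on ?I ?\<Phi>" "smooth_on ?I (inv_into ?I ?\<Phi>)"
    using H(1) unfolding diffeomorphism_def by blast+
  have "smooth_on ?I (\<lambda>(t, A). (t, G t A))"
    by (rule smooth_on_cong[OF smo(2)]) (use G in auto)
  moreover have "G t A \<in> RP3 \<and> H t (G t A) = A" if "t \<in> {0..1}" "A \<in> RP3" for t A
    using bij_betw_inv_into_right[OF b, of "(t, A)"] bij_betw_apply[OF bij_betw_inv_into[OF b], of "(t, A)"]
      that G[of t A] by simp
  moreover have "H t A \<in> RP3" if "t \<in> {0..1}" "A \<in> RP3" for t A
    using bij_betw_apply[OF b, of "(t, A)"] that by simp
  ultimately have "diffeomorphism ?I ?I (\<lambda>(t, A). (t, G t A))"
    using GH by (intro diffeomorphismI[OF _ smo(1)]) (simp_all add: case_prod_unfold mem_Times_iff)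
  moreover have "G 0 A = A" if "A \<in> RP3" for A using GH[of 0 A] H(2) that by simp
  moreover have "G 1 ` K' = K"
  proof -
    have "G 1 ` K' = (\<lambda>A. G 1 (H 1 A)) ` K" unfolding H(3)[symmetric] image_image ..
    also have "\<dots> = (\<lambda>A. A) ` K" by (rule image_cong) (use GH[of 1] K in auto)
    finally show ?thesis by simp
  qed
  ultimately show ?thesis unfolding ambient_isotopic_def by (intro exI[of _ G]) simp
qed

lemma ambient_isotopic_trans:
  assumes "ambient_isotopic K K'" "ambient_isotopic K' K''" shows "ambient_isotopic K K''"
proof -
  let ?I = "{0..1::real} \<times> RP3"
  obtain H where H: "diffeomorphism ?I ?I (\<lambda>(t::real, A). (t, H t A))"
    "\<forall>A\<in>RP3. H 0 A = A" "H 1 ` K = K'"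
    using assms(1) unfolding ambient_isotopic_def by (elim exE conjE)
  obtain G where G: "diffeomorphism ?I ?I (\<lambda>(t::real, A). (t, G t A))"
    "\<forall>A\<in>RP3. G 0 A = A" "G 1 ` K' = K''"
    using assms(2) unfolding ambient_isotopic_def by (elim exE conjE)
  have "diffeomorphism ?I ?I (\<lambda>(t, A). (t, G t (H t A)))"
    using diffeomorphism_comp[OF H(1) G(1)] by (simp add: case_prod_unfold)
  moreover have "(\<lambda>A. G 1 (H 1 A)) ` K = K''"
    unfolding image_image[symmetric] H(3) G(3) ..
  moreover have "\<forall>A\<in>RP3. G 0 (H 0 A) = A" using H(2) G(2) by simp
  ultimately show ?thesis unfolding ambient_isotopic_def
    by (intro exI[of _ "\<lambda>t A. G t (H t A)"] conjI)
qed

lemma smooth_on_id: "smooth_on S (\<lambda>x. x)"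
  by (rule smooth_onI[of UNIV _ "\<lambda>x. x"]) (auto intro: Ck_on_linear bounded_linear_ident)

lemma ambient_isotopic_refl: "ambient_isotopic K K"
  unfolding ambient_isotopic_def
  by (intro exI[of _ "\<lambda>t A. A"] conjI diffeomorphismI[where g = "\<lambda>x. x"]) (use smooth_on_id in \<open>auto simp: case_prod_beta id_def\<close>)

section \<open>Projective transformations and projective lines\<close>

text \<open>
  The quotient by the trace replaces the normalization of homogeneous coordinates: \<open>hpt x\<close> is the point
  with homogeneous coordinates \<open>x\<close>, not necessarily of norm 1, and all formulas are rational
  in the matrix entries.
\<close>

definition normalized :: "real^4^4 \<Rightarrow> real^4^4" where
  "normalized A = inverse (trace A) *\<^sub>R A"

definition hpt :: "real^4 \<Rightarrow> real^4^4" where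
  "hpt x = normalized (proj_pt x)"

text \<open>The projective transformation given by \<open>M\<close>: congruence carries
  \<open>x x\<^sup>T\<close> to \<open>(M x) (M x)\<^sup>T\<close>.\<close>

definition act :: "real^4^4 \<Rightarrow> real^4^4 \<Rightarrow> real^4^4" where
  "act M A = normalized (M ** A ** transpose M)"

lemma trace_proj_pt: "trace (proj_pt x) = x \<bullet> x"
  by (simp add: trace_def proj_pt_def inner_vec_def)

lemma proj_pt_scaleR: "proj_pt (c *\<^sub>R x) = (c * c) *\<^sub>R proj_pt x"
  by (simp add: proj_pt_def vec_eq_iff)

lemma trace_scaleR: "trace (c *\<^sub>R A) = c * trace (A :: real^4^4)"
  by (simp add: trace_def sum_distrib_left)

lemma hpt_scaleR: "c \<noteq> 0 \<Longrightarrow> hpt (c *\<^sub>R x) = hpt x"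
  by (cases "x = 0") (simp_all add: hpt_def normalized_def trace_proj_pt proj_pt_scaleR trace_scaleR field_simps)

lemma hpt_unit: "norm x = 1 \<Longrightarrow> hpt x = proj_pt x"
  by (simp add: hpt_def normalized_def trace_proj_pt dot_square_norm)

lemma hpt_image_cone:
  assumes "\<And>c x. x \<in> W \<Longrightarrow> c *\<^sub>R x \<in> W"
  shows "hpt ` (W - {0}) = proj_pt ` (W \<inter> sphere 0 1)"
proof
  show "hpt ` (W - {0}) \<subseteq> proj_pt ` (W \<inter> sphere 0 1)"
  proof (rule image_subsetI)
    fix x assume "x \<in> W - {0}"
    then have x: "x \<in> W" "x \<noteq> 0" by auto
    let ?y = "inverse (norm x) *\<^sub>R x"
    have "hpt x = proj_pt ?y" using hpt_unit[of ?y] hpt_scaleR[of "inverse (norm x)" x] x by simp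
    moreover have "?y \<in> W \<inter> sphere 0 1" using assms x by simp
    ultimately show "hpt x \<in> proj_pt ` (W \<inter> sphere 0 1)" by blast
  qed
  show "proj_pt ` (W \<inter> sphere 0 1) \<subseteq> hpt ` (W - {0})"
  proof (rule image_subsetI)
    fix x assume "x \<in> W \<inter> sphere 0 1"
    then have x: "x \<in> W" "x \<in> sphere 0 1" by auto
    have "proj_pt x = hpt x" "x \<noteq> 0" using x by (auto simp: hpt_unit)
    then show "proj_pt x \<in> hpt ` (W - {0})" using x by blast
  qed
qed

lemma RP3_hpt: "RP3 = hpt ` (- {0})"
  using hpt_image_cone[of UNIV] by (simp add: RP3_def Compl_eq_Diff_UNIV)

lemma hpt_in_RP3: "x \<noteq> 0 \<Longrightarrow> hpt x \<in> RP3"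
  by (simp add: RP3_hpt)

lemma conj_proj_pt: "M ** proj_pt x ** transpose M = proj_pt (M *v x)"
  by (simp add: vec_eq_iff proj_pt_def matrix_matrix_mult_def matrix_vector_mult_def transpose_def
      sum_distrib_left sum_distrib_right mult_ac)

lemma act_conj_hpt:
  assumes "x \<noteq> 0"
  shows "M ** hpt x ** transpose M = inverse (x \<bullet> x) *\<^sub>R proj_pt (M *v x)"
  unfolding hpt_def normalized_def trace_proj_pt conj_proj_pt[symmetric]
  by (simp add: vec_eq_iff matrix_matrix_mult_def sum_distrib_left sum_distrib_right mult_ac)

lemma act_hpt:
  assumes "x \<noteq> 0" shows "act M (hpt x) = hpt (M *v x)"
  unfolding act_def act_conj_hpt[OF assms] using assms
  by (simp add: hpt_def normalized_def trace_scaleR)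

lemma bounded_bilinear_matrix_mult: "bounded_bilinear ((**) :: real^4^4 \<Rightarrow> real^4^4 \<Rightarrow> real^4^4)"
  unfolding bilinear_conv_bounded_bilinear[symmetric] bilinear_def
  by (auto intro!: linearI simp: vec_eq_iff matrix_matrix_mult_def sum_distrib_left sum.distrib algebra_simps)

lemma bounded_linear_transpose: "bounded_linear (transpose :: real^4^4 \<Rightarrow> real^4^4)"
  unfolding linear_conv_bounded_linear[symmetric] by (auto intro!: linearI simp: transpose_def vec_eq_iff)

lemma bounded_linear_trace: "bounded_linear (trace :: real^4^4 \<Rightarrow> real)"
  unfolding linear_conv_bounded_linear[symmetric] by (auto intro!: linearI simp: trace_add trace_scaleR)

lemma smooth_on_Pair:
  assumes "smooth_on S f" "smooth_on S g" shows "smooth_on S (\<lambda>x. (f x, g x))"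
  unfolding smooth_on_def
proof
  fix x assume x: "x \<in> S"
  obtain U F where U: "open U" "x \<in> U" "\<forall>k. Ck_on k F U" "\<forall>y\<in>U \<inter> S. F y = f y"
    by (rule smooth_onE[OF assms(1) x])
  obtain V G where V: "open V" "x \<in> V" "\<forall>k. Ck_on k G V" "\<forall>y\<in>V \<inter> S. G y = g y"
    by (rule smooth_onE[OF assms(2) x])
  have o: "open (U \<inter> V)" using U V by blast
  have "Ck_on k (\<lambda>x. (F x, G x)) (U \<inter> V)" for k
    by (intro Ck_on_Pair o Ck_on_mono_open[OF U(3)[rule_format]] Ck_on_mono_open[OF V(3)[rule_format]]) auto
  moreover have "(F y, G y) = (f y, g y)" if "y \<in> U \<inter> V \<inter> S" for y using U(4) V(4) that by simp
  moreover have "x \<in> U \<inter> V" using U V by blast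
  ultimately show "\<exists>U H. open U \<and> x \<in> U \<and> (\<forall>k. Ck_on k H U) \<and> (\<forall>y\<in>U \<inter> S. H y = (f y, g y))"
    using o by (intro exI[of _ "U \<inter> V"] exI[of _ "\<lambda>x. (F x, G x)"] conjI allI ballI)
qed

lemma Ck_on_normalized:
  assumes "open U" "Ck_on k F U" "\<And>x. x \<in> U \<Longrightarrow> trace (F x) \<noteq> 0"
  shows "Ck_on k (\<lambda>x. normalized (F x)) U"
  unfolding normalized_def
  by (intro Ck_on_bilinear[OF assms(1) bounded_bilinear_scaleR] Ck_on_inverse
      Ck_on_linear_comp[OF assms(1) bounded_linear_trace] assms)

lemma Ck_on_conj:
  fixes M A :: "'a::euclidean_space \<Rightarrow> real^4^4"
  assumes "open U" "Ck_on k M U" "Ck_on k A U"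
  shows "Ck_on k (\<lambda>x. M x ** A x ** transpose (M x)) U"
  by (rule Ck_on_bilinear[OF assms(1) bounded_bilinear_matrix_mult
        Ck_on_bilinear[OF assms(1) bounded_bilinear_matrix_mult assms(2,3)]
        Ck_on_linear_comp[OF assms(1) bounded_linear_transpose assms(2)]])

text \<open>The only danger is the division by the trace, which at \<open>hpt x\<close> is a
  positive multiple of the squared norm of \<open>M p *v x\<close>. Both arguments depend on a
  parameter so that the lemma covers the isotopy of lines (moving matrix) and the torus chart
  (moving point).\<close>

lemma smooth_on_act:
  assumes M: "\<And>k. Ck_on k M UNIV" "\<And>p. p \<in> S \<Longrightarrow> \<exists>x. x \<noteq> 0 \<and> M p *v x \<noteq> 0 \<and> A p = hpt x"
    and A: "\<And>k. Ck_on k A UNIV"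
  shows "smooth_on S (\<lambda>p. act (M p) (A p))"
proof -
  let ?C = "\<lambda>p. M p ** A p ** transpose (M p)"
  define U where "U = {p. trace (?C p) \<noteq> 0}"
  have C: "Ck_on k ?C UNIV" for k by (intro Ck_on_conj M A) simp
  have "continuous_on UNIV (\<lambda>p. trace (?C p))"
    using bounded_linear.continuous_on[OF bounded_linear_trace Ck_on_imp_continuous[OF C[of 0]]] .
  then have "open U" unfolding U_def by (simp add: open_Collect_neq)
  moreover have "S \<subseteq> U"
  proof
    fix p assume "p \<in> S"
    then obtain x where "x \<noteq> 0" "M p *v x \<noteq> 0" "A p = hpt x" using M(2) by blast
    then show "p \<in> U" by (simp add: U_def act_conj_hpt trace_scaleR trace_proj_pt)
  qed
  moreover have "Ck_on k (\<lambda>p. act (M p) (A p)) U" for k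
    unfolding act_def
    by (intro Ck_on_normalized \<open>open U\<close> Ck_on_mono_open[OF C]) (simp_all add: U_def)
  ultimately show ?thesis by (rule smooth_onI) simp
qed

text \<open>Two planes have a common complement \<open>span {p, q}\<close>, because proper subspaces
  are negligible. The map \<open>n\<close> kills this complement and moves each basis vector of
  \<open>W\<close> along it into \<open>W'\<close>, so its square is 0, and
  \<open>x + t n(x)\<close> is inverted by \<open>x - t n(x)\<close> for every \<open>t\<close>: a
  straight path of invertible maps.\<close>

lemma ex_shear_between_planes:
  fixes W W' :: "(real^4) set"
  assumes W: "subspace W" "dim W = 2" and W': "subspace W'" "dim W' = 2"
  obtains n where "linear n" "\<And>x. n (n x) = 0" "(\<lambda>x. x + n x) ` W = W'"
proof -
  have "negligible (W \<union> W')" using W W' by (intro negligible_Un negligible_lowdim) auto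
  then obtain p where p: "p \<notin> W" "p \<notin> W'" using non_negligible_UNIV by (metis UNIV_I UnCI subsetI top.extremum_uniqueI)
  have sp: "span W = W" "span W' = W'" using W W' by simp_all
  have dp: "dim (insert p W) = 3" "dim (insert p W') = 3"
    using p W W' by (simp_all add: dim_insert sp)
  have "negligible (span (insert p W) \<union> span (insert p W'))"
    using dp by (intro negligible_Un negligible_lowdim) (simp_all only: dim_span, auto)
  then obtain q where q: "q \<notin> span (insert p W)" "q \<notin> span (insert p W')"
    using non_negligible_UNIV by (metis UNIV_I UnCI subsetI top.extremum_uniqueI)
  have "dim (insert q (insert p W')) = 4" using q dp by (subst dim_insert) simp
  then have full': "span (insert q (insert p W')) = UNIV" by (simp add: dim_eq_full[symmetric])
  obtain B where B: "B \<subseteq> W" "independent B" "W \<subseteq> span B" "card B = dim W"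
    using basis_exists by blast
  have sB: "span B = W" using B W span_minimal by blast
  have s3: "span (insert p B) = span (insert p W)"
    by (simp only: span_insert sB sp)
  have ind: "independent (insert q (insert p B))"
    using B(2) p(1) q(1) sB s3 by (simp add: independent_insertI)
  have "dim (insert p B) = 3" using dp(1) arg_cong[OF s3, of dim] by (simp only: dim_span)
  then have "dim (insert q (insert p B)) = 4" using q s3 by (subst dim_insert) simp
  then have full: "span (insert q (insert p B)) = UNIV" by (simp add: dim_eq_full[symmetric])
  have ex: "\<exists>r. r \<in> span {p, q} \<and> b + r \<in> W'" for b
  proof -
    have "b \<in> span (insert q (insert p W'))" using full' by simp
    then obtain k l where "b - k *\<^sub>R q - l *\<^sub>R p \<in> span W'" by (auto simp: span_breakdown_eq)
    then have "b + (- k *\<^sub>R q - l *\<^sub>R p) \<in> W'" by (simp add: sp algebra_simps)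
    moreover have "- k *\<^sub>R q - l *\<^sub>R p \<in> span {p, q}"
      by (intro span_diff span_scale span_base) auto
    ultimately show ?thesis by blast
  qed
  then obtain r where r: "\<And>b. r b \<in> span {p, q}" "\<And>b. b + r b \<in> W'" by metis
  obtain n where n: "linear n" "\<And>x. x \<in> insert q (insert p B) \<Longrightarrow> n x = (if x \<in> B then r x else 0)"
    using linear_independent_extend[OF ind, of "\<lambda>x. if x \<in> B then r x else 0"] by blast
  have pqB: "p \<notin> B" "q \<notin> B" using p q B(1) span_base[of q "insert p W"] by auto
  have npq: "n x = 0" if "x \<in> span {p, q}" for x
  proof (rule linear_eq_0_on_span[OF n(1) _ that])
    fix y assume "y \<in> {p, q}"
    then show "n y = 0" using n(2)[of y] pqB by auto
  qed
  have nn: "n (n x) = 0" for x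
  proof -
    have "linear (\<lambda>x. n (n x))" using linear_compose[OF n(1) n(1)] by (simp add: o_def)
    moreover have "n (n x) = 0" if "x \<in> insert q (insert p B)" for x
      using n(2)[OF that] npq r linear_0[OF n(1)] by auto
    ultimately show ?thesis using linear_eq_0_on_span[of "\<lambda>x. n (n x)"] full by blast
  qed
  have lin: "linear (\<lambda>x. x + n x)" using linear_compose_add[OF linear_id n(1)] by (simp add: id_def)
  have inj: "inj (\<lambda>x. x + n x)"
  proof (rule injI)
    fix x y assume "x + n x = y + n y"
    then have "x + n x - n (x + n x) = y + n y - n (y + n y)" by simp
    then show "x = y" using nn by (simp add: linear_add[OF n(1)])
  qed
  have "x + n x \<in> W'" if "x \<in> B" for x using n(2)[of x] r(2)[of x] that by simp
  then have "(\<lambda>x. x + n x) ` B \<subseteq> W'" by blast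
  then have "span ((\<lambda>x. x + n x) ` B) \<subseteq> W'" using W'(1) span_minimal by blast
  then have sub: "(\<lambda>x. x + n x) ` W \<subseteq> W'" using sB by (simp add: linear_span_image[OF lin])
  moreover have "dim ((\<lambda>x. x + n x) ` W) = 2" using dim_image_eq[OF lin inj_on_subset[OF inj subset_UNIV]] W by simp
  moreover have "subspace ((\<lambda>x. x + n x) ` W)" by (rule linear_subspace_image[OF lin W(1)])
  ultimately have "(\<lambda>x. x + n x) ` W = W'"
    using subspace_dim_equal[of "(\<lambda>x. x + n x) ` W" W'] W' by simp
  then show thesis by (rule that[OF n(1) nn])
qed

lemma projective_line_iff:
  "projective_line L \<longleftrightarrow> (\<exists>W. subspace W \<and> dim W = 2 \<and> L = hpt ` (W - {0}))"
  unfolding projective_line_def using hpt_image_cone subspace_scale by (metis (no_types, lifting))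

lemma projective_lines_isotopic:
  assumes "projective_line L" "projective_line L'" shows "ambient_isotopic L L'"
proof -
  obtain W where W: "subspace W" "dim W = 2" "L = hpt ` (W - {0})"
    using assms(1) projective_line_iff by blast
  obtain W' where W': "subspace W'" "dim W' = 2" "L' = hpt ` (W' - {0})"
    using assms(2) projective_line_iff by blast
  obtain n where n: "linear n" "\<And>x. n (n x) = 0" "(\<lambda>x. x + n x) ` W = W'"
    using ex_shear_between_planes[OF W(1,2) W'(1,2)] by blast
  define M where "M t = mat 1 + t *\<^sub>R matrix n" for t
  have M: "M t *v x = x + t *\<^sub>R n x" for t x
    using matrix_works[of n x] n(1)
    by (simp add: M_def matrix_vector_mult_add_rdistrib scaleR_matrix_vector_assoc[symmetric] linear_matrix_vector_mul_eq)
  have inv: "M (- t) *v (M t *v x) = x" for t x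
    using n(2) by (simp add: M linear_add[OF n(1)] linear_cmul[OF n(1)])
  then have M0: "M t *v x \<noteq> 0" if "x \<noteq> 0" for t x
    using that by (metis matrix_vector_mult_0_right)
  have hpt: "\<exists>x. x \<noteq> 0 \<and> A = hpt x" if "A \<in> RP3" for A using that by (auto simp: RP3_hpt)
  have aa: "act (M (- t)) (act (M t) A) = A" "act (M t) A \<in> RP3" if A: "A \<in> RP3" for t A
    using hpt[OF A] M0 inv by (auto simp: act_hpt hpt_in_RP3)
  \<comment> \<open>The sign \<open>s\<close> is later 1 for the track and -1 for its
    inverse.\<close>
  have Ck: "Ck_on k (\<lambda>p::real \<times> (real^4^4). M (s * fst p)) UNIV" for k s
    unfolding M_def
    by (intro Ck_on_add Ck_on_const Ck_on_bilinear[OF _ bounded_bilinear_scaleR]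
        Ck_on_linear bounded_linear_const_mult bounded_linear_fst) auto
  have "Ck_on k (snd :: real \<times> (real^4^4) \<Rightarrow> _) UNIV" for k
    by (intro Ck_on_linear bounded_linear_snd) auto
  then have sm: "smooth_on ({0..1} \<times> RP3) (\<lambda>p. act (M (s * fst p)) (snd p))" for s
    using hpt M0 by (intro smooth_on_act Ck) force+
  have fsm: "smooth_on ({0..1} \<times> RP3) (fst :: real \<times> (real^4^4) \<Rightarrow> real)"
    by (rule smooth_onI[of UNIV _ fst]) (auto intro: Ck_on_linear bounded_linear_fst)
  have tr: "smooth_on ({0..1} \<times> RP3) (\<lambda>(t, A). (t, act (M (s * t)) A))" for s
    using smooth_on_Pair[OF fsm sm[of s]] by (simp add: case_prod_unfold)
  have "diffeomorphism ({0..1} \<times> RP3) ({0..1} \<times> RP3) (\<lambda>(t, A). (t, act (M t) A))"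
    using tr[of 1] tr[of "-1"] aa aa(1)[of _ "- t" for t]
    by (intro diffeomorphismI[where g = "\<lambda>(t, A). (t, act (M (- t)) A)"]) auto
  moreover have "\<forall>A\<in>RP3. act (M 0) A = A"
    using aa(1)[of _ 0] by (metis hpt act_hpt M add_0_right scaleR_zero_left)
  moreover have "act (M 1) ` L = L'"
  proof -
    have "act (M 1) ` L = (\<lambda>x. act (M 1) (hpt x)) ` (W - {0})" unfolding W(3) image_image ..
    also have "\<dots> = hpt ` (\<lambda>x. x + n x) ` (W - {0})"
      unfolding image_image by (rule image_cong) (auto simp: act_hpt M)
    also have "(\<lambda>x. x + n x) ` (W - {0}) = W' - {0}"
      using n(3) M0[of _ 1] linear_0[OF n(1)] by (auto simp: M)
    finally show ?thesis using W'(3) by simp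
  qed
  ultimately show ?thesis unfolding ambient_isotopic_def
    by (intro exI[of _ "\<lambda>t. act (M t)"] conjI)
qed

section \<open>Solid tori around projective lines\<close>

text \<open>With \<open>\<real>\<^sup>4 = \<complex>\<^sup>2\<close>, the matrix \<open>N\<close>
  encodes a pair of complementary lines: \<open>ucoord N x = 0\<close> is the line to be avoided,
  and \<open>vcoord N x = 0\<close> will be the core of the solid torus.\<close>

definition ucoord :: "real^4^4 \<Rightarrow> real^4 \<Rightarrow> complex" where
  "ucoord N x = Complex ((N *v x) $ 1) ((N *v x) $ 2)"

definition vcoord :: "real^4^4 \<Rightarrow> real^4 \<Rightarrow> complex" where
  "vcoord N x = Complex ((N *v x) $ 3) ((N *v x) $ 4)"

text \<open>
  The standard solid torus consists of the points with homogeneous coordinates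
  \<open>(\<sigma>, w * \<sigma>)\<close> in \<open>\<complex>\<^sup>2 = \<real>\<^sup>4\<close>, where \<open>norm \<sigma> = 1\<close> and \<open>norm w \<le> 1\<close>; only
  \<open>\<sigma>\<^sup>2\<close> is well defined.  Its real coordinates are \<open>Re (c\<^sub>i * \<sigma>)\<close> for the coefficients \<open>c\<^sub>i\<close>
  below, and \<open>Re a * Re b = (Re (a * b) + Re (a * cnj b)) / 2\<close> makes their products polynomial
  in \<open>\<sigma>\<^sup>2\<close> and \<open>w\<close>.
\<close>

definition torus_coeff :: "complex \<Rightarrow> 4 \<Rightarrow> complex" where
  "torus_coeff w i = (if i = 1 then 1 else if i = 2 then - \<i> else 0)
     + w * (if i = 3 then 1 else if i = 4 then - \<i> else 0)"

definition torus_vec :: "complex \<Rightarrow> complex \<Rightarrow> real^4" where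
  "torus_vec \<sigma> w = (\<chi> i. Re (torus_coeff w i * \<sigma>))"

definition torus_matrix :: "complex \<times> complex \<Rightarrow> real^4^4" where
  "torus_matrix p = (\<chi> i j. (Re (torus_coeff (snd p) i * torus_coeff (snd p) j * fst p)
      + Re (torus_coeff (snd p) i * cnj (torus_coeff (snd p) j))) / 2)"

text \<open>The factor brings the trace to 1, since \<open>1 + w * cnj w\<close> is the squared norm
  of \<open>(\<sigma>, w * \<sigma>)\<close>; the result is then moved by \<open>M\<close>.\<close>

definition torus_chart :: "real^4^4 \<Rightarrow> complex \<times> complex \<Rightarrow> real^4^4" where
  "torus_chart M p = act M (inverse (1 + Re (snd p * cnj (snd p))) *\<^sub>R torus_matrix p)"

text \<open>Both conditions are homogeneous, so they do not depend on the representative.\<close>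

definition torus_nbhd :: "real^4^4 \<Rightarrow> (real^4^4) set" where
  "torus_nbhd N = hpt ` {x. ucoord N x \<noteq> 0 \<and> norm (vcoord N x) \<le> norm (ucoord N x)}"

text \<open>
  The inverse chart \<open>(u\<^sup>2 / norm u\<^sup>2, v * cnj u / norm u\<^sup>2)\<close>, with the products of the real coordinates
  of \<open>u\<close> and \<open>v\<close> read off the matrix.
\<close>

definition torus_coord :: "real^4^4 \<Rightarrow> real^4^4 \<Rightarrow> complex \<times> complex" where
  "torus_coord N A = (let C = N ** A ** transpose N in
     (inverse (C$1$1 + C$2$2) *\<^sub>R Complex (C$1$1 - C$2$2) (2 * C$1$2),
      inverse (C$1$1 + C$2$2) *\<^sub>R Complex (C$1$3 + C$2$4) (C$1$4 - C$2$3)))"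

lemma torus_vec_nth:
  "torus_vec \<sigma> w $ 1 = Re \<sigma>" "torus_vec \<sigma> w $ 2 = Im \<sigma>"
  "torus_vec \<sigma> w $ 3 = Re (w * \<sigma>)" "torus_vec \<sigma> w $ 4 = Im (w * \<sigma>)"
  by (simp_all add: torus_vec_def torus_coeff_def)

lemma vec4_eq_iff: "(x :: real^4) = y \<longleftrightarrow> x$1 = y$1 \<and> x$2 = y$2 \<and> x$3 = y$3 \<and> x$4 = y$4"
  by (simp add: vec_eq_iff forall_4)

lemma torus_vec_nonzero: "\<sigma> \<noteq> 0 \<Longrightarrow> torus_vec \<sigma> w \<noteq> 0"
  by (auto simp: vec4_eq_iff torus_vec_nth complex_eq_iff)

lemma torus_vec_inner: "torus_vec \<sigma> w \<bullet> torus_vec \<sigma> w = (norm \<sigma>)\<^sup>2 * (1 + Re (w * cnj w))"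
  unfolding cmod_power2 by (simp add: inner_vec_def sum_4 torus_vec_nth algebra_simps power2_eq_square)

lemma torus_matrix_eq:
  assumes "norm \<sigma> = 1" shows "torus_matrix (\<sigma>\<^sup>2, w) = proj_pt (torus_vec \<sigma> w)"
proof -
  have "Re a * Re b = (Re (a * b) + Re (a * cnj b)) / 2" for a b by simp
  then have "Re (c * \<sigma>) * Re (d * \<sigma>) = (Re (c * d * \<sigma>\<^sup>2) + Re (c * cnj d)) / 2" for c d
  proof -
    have "(c * \<sigma>) * cnj (d * \<sigma>) = c * cnj d * of_real ((norm \<sigma>)\<^sup>2)"
      unfolding complex_norm_square by (simp add: mult_ac)
    then have "(c * \<sigma>) * cnj (d * \<sigma>) = c * cnj d" using assms by simp
    moreover have "(c * \<sigma>) * (d * \<sigma>) = c * d * \<sigma>\<^sup>2" by (simp add: power2_eq_square mult_ac)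
    ultimately show ?thesis using \<open>Re (c * \<sigma>) * Re (d * \<sigma>) = _\<close> by metis
  qed
  then show ?thesis by (simp add: torus_matrix_def proj_pt_def torus_vec_def vec_eq_iff)
qed

text \<open>Either square root of the circle coordinate yields homogeneous coordinates, since
  \<open>hpt\<close> identifies \<open>x\<close> and \<open>- x\<close>. The square appears because
  half a turn of \<open>\<sigma>\<close> already traverses the projective line once.\<close>

lemma torus_chart_sqrt:
  assumes "norm \<sigma> = 1" shows "torus_chart M (\<sigma>\<^sup>2, w) = hpt (M *v torus_vec \<sigma> w)"
proof -
  have "inverse (1 + Re (w * cnj w)) *\<^sub>R torus_matrix (\<sigma>\<^sup>2, w) = hpt (torus_vec \<sigma> w)"
    unfolding torus_matrix_eq[OF assms] hpt_def normalized_def trace_proj_pt torus_vec_inner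
    using assms by simp
  moreover have "\<sigma> \<noteq> 0" using assms by auto
  ultimately show ?thesis unfolding torus_chart_def by (simp add: act_hpt torus_vec_nonzero)
qed

lemma torus_coord_hpt:
  assumes "x \<noteq> 0" "ucoord N x \<noteq> 0"
  shows "torus_coord N (hpt x) = ((ucoord N x)\<^sup>2 / of_real ((norm (ucoord N x))\<^sup>2), vcoord N x / ucoord N x)"
proof -
  let ?u = "ucoord N x" and ?v = "vcoord N x" and ?y = "N *v x"
  define k where "k = inverse (x \<bullet> x)"
  have k: "k \<noteq> 0" using assms by (simp add: k_def)
  have C: "(N ** hpt x ** transpose N) $ i $ j = k * (?y $ i * ?y $ j)" for i j
    by (simp add: act_conj_hpt[OF assms(1)] proj_pt_def k_def)
  have d: "k * (?y$1 * ?y$1) + k * (?y$2 * ?y$2) = k * (norm ?u)\<^sup>2"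
    unfolding cmod_power2 by (simp add: ucoord_def power2_eq_square algebra_simps)
  have n: "(norm ?u)\<^sup>2 \<noteq> 0" using assms by simp
  have "Complex (k * (?y$1 * ?y$1) - k * (?y$2 * ?y$2)) (2 * (k * (?y$1 * ?y$2))) = of_real k * ?u\<^sup>2"
    by (simp add: complex_eq_iff ucoord_def power2_eq_square algebra_simps)
  moreover have "Complex (k * (?y$1 * ?y$3) + k * (?y$2 * ?y$4)) (k * (?y$1 * ?y$4) - k * (?y$2 * ?y$3))
      = of_real k * (?v * cnj ?u)"
    by (simp add: complex_eq_iff ucoord_def vcoord_def algebra_simps)
  ultimately have "torus_coord N (hpt x) = (inverse (k * (norm ?u)\<^sup>2) *\<^sub>R (of_real k * ?u\<^sup>2),
      inverse (k * (norm ?u)\<^sup>2) *\<^sub>R (of_real k * (?v * cnj ?u)))"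
    unfolding torus_coord_def Let_def C d by (simp only:)
  also have "\<dots> = (?u\<^sup>2 / of_real ((norm ?u)\<^sup>2), (?v * cnj ?u) / of_real ((norm ?u)\<^sup>2))"
    using k n by (simp add: scaleR_conv_of_real field_simps)
  also have "(?v * cnj ?u) / of_real ((norm ?u)\<^sup>2) = ?v / ?u"
    unfolding complex_norm_square using assms(2) by (simp add: field_simps)
  finally show ?thesis .
qed

lemma smooth_on_torus_chart:
  assumes "\<And>x. x \<noteq> 0 \<Longrightarrow> M *v x \<noteq> 0" shows "smooth_on std_solid_torus (torus_chart M)"
proof -
  have c: "Ck_on k (\<lambda>p::complex\<times>complex. torus_coeff (snd p) i) UNIV" for k i
    unfolding torus_coeff_def
    by (intro Ck_on_add Ck_on_bilinear[OF _ bounded_bilinear_mult] Ck_on_const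
        Ck_on_linear bounded_linear_snd) auto
  have B: "Ck_on k torus_matrix UNIV" for k
  proof -
    have "Ck_on k (\<lambda>p. torus_matrix p $ i $ j) UNIV" for i j
      unfolding torus_matrix_def vec_lambda_beta
      by (intro Ck_on_linear_comp[OF _ bounded_linear_divide] Ck_on_add
          Ck_on_linear_comp[OF _ bounded_linear_Re] Ck_on_bilinear[OF _ bounded_bilinear_mult] c
          Ck_on_linear_comp[OF _ bounded_linear_cnj] Ck_on_linear bounded_linear_fst) auto
    then show ?thesis by (intro Ck_on_vec) auto
  qed
  have pos: "1 + Re (w * cnj w) \<noteq> 0" for w :: complex
    by (simp add: complex_mult_cnj) (smt (verit) zero_le_power2)
  have A: "Ck_on k (\<lambda>p. inverse (1 + Re (snd p * cnj (snd p))) *\<^sub>R torus_matrix p) UNIV" for k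
    by (intro Ck_on_bilinear[OF _ bounded_bilinear_scaleR] B Ck_on_inverse Ck_on_add Ck_on_const pos
        Ck_on_linear_comp[OF _ bounded_linear_Re] Ck_on_bilinear[OF _ bounded_bilinear_mult]
        Ck_on_linear_comp[OF _ bounded_linear_cnj] Ck_on_linear bounded_linear_snd) auto
  have "\<exists>x. x \<noteq> 0 \<and> M *v x \<noteq> 0 \<and> inverse (1 + Re (snd p * cnj (snd p))) *\<^sub>R torus_matrix p = hpt x"
    if "p \<in> std_solid_torus" for p
  proof -
    obtain s w where p: "p = (s, w)" "norm s = 1" using \<open>p \<in> std_solid_torus\<close> by (auto simp: std_solid_torus_def)
    define \<sigma> where "\<sigma> = csqrt s"
    have \<sigma>: "\<sigma>\<^sup>2 = s" "norm \<sigma> = 1" using p(2) by (auto simp: \<sigma>_def norm_csqrt)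
    have "inverse (1 + Re (w * cnj w)) *\<^sub>R torus_matrix (\<sigma>\<^sup>2, w) = hpt (torus_vec \<sigma> w)"
      unfolding torus_matrix_eq[OF \<sigma>(2)] hpt_def normalized_def trace_proj_pt torus_vec_inner
      using \<sigma> by simp
    moreover have "\<sigma> \<noteq> 0" using \<sigma>(2) by auto
    then have "torus_vec \<sigma> w \<noteq> 0" by (rule torus_vec_nonzero)
    ultimately show ?thesis using p(1) \<sigma>(1) assms
      by (intro exI[of _ "torus_vec \<sigma> w"]) simp
  qed
  then show ?thesis unfolding torus_chart_def
    by (intro smooth_on_act A Ck_on_const open_UNIV)
qed

lemma smooth_on_torus_coord: "smooth_on (torus_nbhd N) (torus_coord N)"
proof -
  let ?C = "\<lambda>A. N ** A ** transpose N"
  \<comment> \<open>On the solid torus this denominator is a positive multiple of the squared norm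
    of \<open>u\<close>.\<close>
  define U where "U = {A. ?C A $1$1 + ?C A $2$2 \<noteq> 0}"
  have C: "Ck_on k (\<lambda>A. ?C A $ i $ j) V" if "open V" for k i j V
    by (intro Ck_on_linear_comp[OF that bounded_linear_vec_nth] Ck_on_conj Ck_on_const
        Ck_on_linear bounded_linear_ident that)
  have "continuous_on UNIV (\<lambda>A. ?C A $1$1 + ?C A $2$2)"
    using Ck_on_imp_continuous[OF C[of UNIV 0]] by (intro continuous_on_add) auto
  then have U: "open U" unfolding U_def by (simp add: open_Collect_neq)
  have Complex_eq': "Complex a b = a *\<^sub>R 1 + b *\<^sub>R \<i>" for a b by (simp add: complex_eq_iff)
  have "Ck_on k (torus_coord N) U" for k
    unfolding torus_coord_def[abs_def] Let_def Complex_eq' diff_conv_add_uminus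
    by (intro Ck_on_Pair Ck_on_bilinear[OF U bounded_bilinear_scaleR] Ck_on_inverse Ck_on_add C Ck_on_const
        Ck_on_linear_comp[OF U bounded_linear_minus[OF bounded_linear_ident]]
        Ck_on_bilinear[OF U bounded_bilinear_mult] U) (auto simp: U_def)
  moreover have "torus_nbhd N \<subseteq> U"
  proof
    fix A assume "A \<in> torus_nbhd N"
    then obtain x where x: "A = hpt x" "ucoord N x \<noteq> 0" by (auto simp: torus_nbhd_def)
    then have "x \<noteq> 0" by (auto simp: ucoord_def complex_eq_iff)
    moreover have "((N *v x)$1)\<^sup>2 + ((N *v x)$2)\<^sup>2 \<noteq> 0"
      using x(2) by (auto simp: ucoord_def complex_eq_iff sum_power2_eq_zero_iff)
    ultimately show "A \<in> U"
      by (simp add: U_def x(1) act_conj_hpt proj_pt_def power2_eq_square flip: distrib_left)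
  qed
  ultimately show ?thesis using U by (intro smooth_onI) auto
qed

context
  fixes M N :: "real^4^4"
  assumes MN: "M ** N = mat 1" and NM: "N ** M = mat 1"
begin

lemma inverse_mult_vec: "M *v (N *v x) = x" "N *v (M *v x) = x"
  by (simp_all add: matrix_vector_mul_assoc MN NM)

lemma coords_torus_vec:
  "ucoord N (M *v torus_vec \<sigma> w) = \<sigma>" "vcoord N (M *v torus_vec \<sigma> w) = w * \<sigma>"
  by (simp_all add: ucoord_def vcoord_def inverse_mult_vec torus_vec_nth complex_eq_iff)

lemma torus_chart_coords:
  assumes "ucoord N x \<noteq> 0"
  shows "torus_chart M ((ucoord N x)\<^sup>2 / of_real ((norm (ucoord N x))\<^sup>2), vcoord N x / ucoord N x) = hpt x"
proof -
  let ?u = "ucoord N x" and ?v = "vcoord N x"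
  \<comment> \<open>\<open>sgn ?u\<close> is a square root of the circle coordinate, and rescaling
    \<open>N *v x\<close> to \<open>norm u = 1\<close> gives the form
    \<open>(\<sigma>, w * \<sigma>)\<close>.\<close>
  have "torus_vec (sgn ?u) (?v / ?u) = inverse (norm ?u) *\<^sub>R (N *v x)"
  proof -
    have "?v / ?u * sgn ?u = inverse (norm ?u) *\<^sub>R ?v"
      using assms by (simp add: sgn_div_norm scaleR_conv_of_real)
    then show ?thesis
      by (simp add: vec4_eq_iff torus_vec_nth sgn_div_norm) (simp add: ucoord_def vcoord_def)
  qed
  then have "hpt (M *v torus_vec (sgn ?u) (?v / ?u)) = hpt x"
    using assms by (simp add: hpt_scaleR matrix_vector_mult_scaleR inverse_mult_vec)
  moreover have "?u\<^sup>2 / of_real ((norm ?u)\<^sup>2) = (sgn ?u)\<^sup>2"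
    by (simp add: sgn_div_norm scaleR_conv_of_real power_mult_distrib divide_simps)
  ultimately show ?thesis using torus_chart_sqrt[of "sgn ?u"] assms by (simp add: norm_sgn)
qed

lemma framing_torus_chart: "framing (torus_nbhd N) (torus_chart M)"
  unfolding framing_def
proof
  show "torus_nbhd N \<subseteq> RP3"
    by (auto simp: torus_nbhd_def ucoord_def complex_eq_iff intro!: hpt_in_RP3)
  have M0: "x \<noteq> 0 \<Longrightarrow> M *v x \<noteq> 0" for x using inverse_mult_vec(2)[of x] by auto
  show "diffeomorphism std_solid_torus (torus_nbhd N) (torus_chart M)"
  proof (rule diffeomorphismI)
    show "smooth_on std_solid_torus (torus_chart M)" using M0 by (rule smooth_on_torus_chart)
    show "smooth_on (torus_nbhd N) (torus_coord N)" by (rule smooth_on_torus_coord)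
  next
    fix p assume "p \<in> std_solid_torus"
    then obtain s w where p: "p = (s, w)" "norm s = 1" "norm w \<le> 1" by (auto simp: std_solid_torus_def)
    define \<sigma> where "\<sigma> = csqrt s"
    have \<sigma>: "s = \<sigma>\<^sup>2" "norm \<sigma> = 1" using p(2) by (auto simp: \<sigma>_def norm_csqrt)
    have s0: "\<sigma> \<noteq> 0" using \<sigma>(2) by auto
    then have x0: "M *v torus_vec \<sigma> w \<noteq> 0" using M0 torus_vec_nonzero by blast
    have "torus_chart M p = hpt (M *v torus_vec \<sigma> w)" unfolding p \<sigma>(1) by (rule torus_chart_sqrt[OF \<sigma>(2)])
    moreover have "hpt (M *v torus_vec \<sigma> w) \<in> torus_nbhd N"
      unfolding torus_nbhd_def using p(3) \<sigma>(2) s0 by (intro imageI) (simp add: coords_torus_vec norm_mult)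
    moreover have "torus_coord N (hpt (M *v torus_vec \<sigma> w)) = p"
      using torus_coord_hpt[OF x0] s0 \<sigma> p(1) by (simp add: coords_torus_vec)
    ultimately show "torus_chart M p \<in> torus_nbhd N \<and> torus_coord N (torus_chart M p) = p" by simp
  next
    fix A assume "A \<in> torus_nbhd N"
    then obtain x where x: "A = hpt x" "ucoord N x \<noteq> 0" "norm (vcoord N x) \<le> norm (ucoord N x)"
      by (auto simp: torus_nbhd_def)
    then have "x \<noteq> 0" by (auto simp: ucoord_def complex_eq_iff)
    note c = torus_coord_hpt[OF this x(2)]
    have "torus_coord N A \<in> std_solid_torus"
      using x by (simp add: x(1) c std_solid_torus_def norm_divide norm_power)
    then show "torus_coord N A \<in> std_solid_torus \<and> torus_chart M (torus_coord N A) = A"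
      using torus_chart_coords[OF x(2)] x(1) c by simp
  qed
qed

text \<open>The core is the locus \<open>v = 0\<close>; its plane is the image under
  \<open>M\<close> of a coordinate plane.\<close>

lemma projective_line_core: "projective_line (torus_chart M ` (sphere 0 1 \<times> {0}))"
proof -
  let ?B = "{axis 1 1, axis 2 1} :: (real^4) set"
  let ?W = "(*v) M ` span ?B"
  have W0: "span ?B = {y. y $ 3 = 0 \<and> y $ 4 = 0}"
  proof
    show "span ?B \<subseteq> {y. y $ 3 = 0 \<and> y $ 4 = 0}"
      by (intro span_minimal) (auto simp: axis_def subspace_def)
    show "{y. y $ 3 = 0 \<and> y $ 4 = 0} \<subseteq> span ?B"
    proof
      fix y :: "real^4" assume "y \<in> {y. y $ 3 = 0 \<and> y $ 4 = 0}"
      then have "y = y $ 1 *\<^sub>R axis 1 1 + y $ 2 *\<^sub>R axis 2 1" by (simp add: vec4_eq_iff axis_def)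
      also have "\<dots> \<in> span ?B" by (intro span_add span_scale span_base) auto
      finally show "y \<in> span ?B" .
    qed
  qed
  have "independent ?B"
    by (rule independent_mono[OF independent_Basis]) (auto simp: axis_in_Basis_iff)
  moreover have "card ?B = 2" by (simp add: axis_eq_axis)
  ultimately have d: "dim (span ?B) = 2" by (simp add: dim_eq_card_independent)
  have lin: "linear ((*v) M)" by (rule matrix_vector_mul_linear)
  have "inj ((*v) M)" by (metis injI inverse_mult_vec(2))
  then have "dim ?W = 2" using dim_image_eq[OF lin, of "span ?B"] d by (simp add: inj_on_subset)
  moreover have "subspace ?W" by (intro linear_subspace_image lin) simp
  moreover have "torus_chart M ` (sphere 0 1 \<times> {0}) = hpt ` (?W - {0})"
  proof
    show "torus_chart M ` (sphere 0 1 \<times> {0}) \<subseteq> hpt ` (?W - {0})"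
    proof (rule image_subsetI)
      fix p assume "p \<in> sphere (0::complex) 1 \<times> {0::complex}"
      then obtain s where p: "p = (s, 0)" "norm s = 1" by auto
      define \<sigma> where "\<sigma> = csqrt s"
      have \<sigma>: "s = \<sigma>\<^sup>2" "norm \<sigma> = 1" using p(2) by (auto simp: \<sigma>_def norm_csqrt)
      then have "M *v torus_vec \<sigma> 0 \<noteq> 0" using coords_torus_vec(1)[of \<sigma> 0]
        unfolding ucoord_def by (metis Complex_eq_0 matrix_vector_mult_0_right norm_zero zero_index zero_neq_one)
      moreover have "torus_vec \<sigma> 0 \<in> span ?B" unfolding W0 by (simp add: torus_vec_nth)
      ultimately show "torus_chart M p \<in> hpt ` (?W - {0})"
        using torus_chart_sqrt[OF \<sigma>(2), of M 0] p \<sigma>(1) by blast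
    qed
    show "hpt ` (?W - {0}) \<subseteq> torus_chart M ` (sphere 0 1 \<times> {0})"
    proof (rule image_subsetI)
      fix x assume "x \<in> ?W - {0}"
      then obtain y where y: "x = M *v y" "y $ 3 = 0" "y $ 4 = 0" "x \<noteq> 0" unfolding W0 by auto
      then have v: "vcoord N x = 0" by (simp add: vcoord_def inverse_mult_vec complex_eq_iff)
      have u: "ucoord N x \<noteq> 0"
      proof
        assume "ucoord N x = 0"
        then have "y = 0" using y by (simp add: ucoord_def inverse_mult_vec complex_eq_iff vec4_eq_iff)
        then show False using y by simp
      qed
      have "hpt x = torus_chart M ((ucoord N x)\<^sup>2 / of_real ((norm (ucoord N x))\<^sup>2), 0)"
        using torus_chart_coords[OF u] v by simp
      moreover have "norm ((ucoord N x)\<^sup>2 / of_real ((norm (ucoord N x))\<^sup>2)) = 1"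
        using u by (simp add: norm_divide norm_power)
      ultimately show "hpt x \<in> torus_chart M ` (sphere 0 1 \<times> {0})" by force
    qed
  qed
  ultimately show ?thesis unfolding projective_line_iff by blast
qed

end

section \<open>Maps of the circle and of the solid torus\<close>

lemma real_Ints_constant:
  fixes d :: "'a::topological_space \<Rightarrow> real"
  assumes "connected S" "continuous_on S d" "\<And>x. x \<in> S \<Longrightarrow> d x \<in> \<int>" "x \<in> S" "y \<in> S"
  shows "d x = d y"
proof -
  have "\<exists>e>0. \<forall>y. y \<in> S \<and> d y \<noteq> d x \<longrightarrow> e \<le> norm (d y - d x)" if "x \<in> S" for x
  proof (intro exI[of _ 1] conjI allI impI)
    fix y assume "y \<in> S \<and> d y \<noteq> d x"
    then have "d y - d x \<in> \<int>" "d y - d x \<noteq> 0" using assms(3) that by auto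
    then show "1 \<le> norm (d y - d x)" using Ints_nonzero_abs_ge1[of "d y - d x"] by simp
  qed simp
  then have "d constant_on S" using continuous_discrete_range_constant[OF assms(1,2)] by blast
  then show ?thesis using assms(4,5) by (auto simp: constant_on_def)
qed

lemma cis_eq_cis_imp_Ints:
  assumes "cis a = cis b" shows "(a - b) / (2 * pi) \<in> \<int>"
proof -
  have "exp (\<i> * of_real a) = exp (\<i> * of_real b)" using assms by (simp add: cis_conv_exp)
  then obtain n :: int where "\<i> * of_real a = \<i> * of_real b + of_int (2 * n) * of_real pi * \<i>"
    by (auto simp: exp_eq)
  then have "Im (\<i> * of_real a) = Im (\<i> * of_real b + of_int (2 * n) * of_real pi * \<i>)" by (rule arg_cong)
  then have "(a - b) / (2 * pi) = of_int n" by (simp add: field_simps)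
  then show ?thesis by simp
qed

lemma continuous_on_cis_real: "continuous_on S f \<Longrightarrow> continuous_on S (\<lambda>x. cis (f x))"
  by (simp add: cis_conv_exp) (intro continuous_intros)

lemma continuous_on_sphere_cis:
  "continuous_on (sphere 0 1) f \<Longrightarrow> continuous_on UNIV (\<lambda>t. f (cis t))"
  by (rule continuous_on_compose2[where g = f and f = cis]) (auto intro: continuous_on_cis_real continuous_intros)

text \<open>Along \<open>cis t\<close>, both \<open>\<eta> (cis t)\<close> and \<open>n * t\<close>
  are arguments of the same value, so they differ by a constant; after one turn the first has
  returned, while the second has grown by \<open>2 * pi * n\<close>.\<close>

lemma circle_power_eq_cis:
  fixes n :: int
  assumes "continuous_on (sphere 0 1) \<eta>" "\<And>z. z \<in> sphere 0 1 \<Longrightarrow> z powi n = cis (\<eta> z)"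
  shows "n = 0"
proof -
  define d where "d t = (\<eta> (cis t) - of_int n * t) / (2 * pi)" for t
  have "d t \<in> \<int>" for t
    unfolding d_def using assms(2)[of "cis t"] by (intro cis_eq_cis_imp_Ints) (simp add: cis_power_int)
  moreover have "continuous_on UNIV d"
    unfolding d_def by (intro continuous_intros continuous_on_sphere_cis assms(1)) auto
  ultimately have "d 0 = d (2 * pi)" by (intro real_Ints_constant[of UNIV]) auto
  then show ?thesis by (simp add: d_def)
qed

text \<open>This normal form stands in for a definition of the degree: \<open>n\<close> is the
  growth of a lifted angle \<open>L\<close> over one period divided by \<open>2 * pi\<close>, and
  \<open>L t - n * t\<close> is periodic, hence descends to the circle.\<close>

lemma circle_map_degree:
  assumes f: "continuous_on (sphere 0 1) f" "f ` sphere 0 1 \<subseteq> sphere 0 1"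
  obtains n :: int and \<eta> where "continuous_on (sphere 0 1) \<eta>"
    "\<forall>z\<in>sphere 0 1. f z = z powi n * cis (\<eta> z)"
proof -
  have nf: "norm (f (cis t)) = 1" for t
  proof -
    have "f (cis t) \<in> f ` sphere 0 1" by (rule imageI) simp
    then show ?thesis using subsetD[OF f(2), of "f (cis t)"] by simp
  qed
  have "f (cis t) \<noteq> 0" for t using nf[of t] by auto
  then obtain g where g: "continuous_on UNIV g" "\<And>t. f (cis t) = exp (g t)"
    using continuous_logarithm_on_contractible[OF continuous_on_sphere_cis[OF f(1)] contractible_UNIV] by auto
  define L where "L t = Im (g t)" for t
  have cL: "continuous_on UNIV L" unfolding L_def by (intro continuous_intros g)
  have L: "f (cis t) = cis (L t)" for t
  proof -
    have "exp (Re (g t)) = 1" using nf[of t] g(2)[of t] by simp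
    then show ?thesis using g(2)[of t] by (simp add: L_def exp_eq_polar)
  qed
  define d where "d t = (L (t + 2 * pi) - L t) / (2 * pi)" for t
  have dI: "d t \<in> \<int>" for t
    unfolding d_def by (intro cis_eq_cis_imp_Ints) (simp add: L[symmetric] cis_mult[symmetric])
  have "continuous_on UNIV (\<lambda>t. L (t + 2 * pi))"
    by (rule continuous_on_compose2[OF cL]) (auto intro: continuous_intros)
  then have "continuous_on UNIV d" unfolding d_def by (intro continuous_intros cL) auto
  then have dc: "d t = d 0" for t using dI by (intro real_Ints_constant[of UNIV]) auto
  obtain n where n: "d 0 = of_int n" using dI Ints_cases by blast
  define h where "h t = L t - of_int n * t" for t
  have ch: "isCont h t" for t
    using cL unfolding h_def by (intro continuous_intros) (simp add: continuous_on_eq_continuous_at)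
  have hper: "h (t + 2 * pi) = h t" for t
    using dc[of t] n by (simp add: d_def h_def field_simps)
  define \<eta> where "\<eta> z = h (Arg z)" for z
  \<comment> \<open>\<open>Arg\<close> jumps at the negative half-axis, but
    \<open>Arg (- z) + pi\<close> is continuous there and differs from \<open>Arg z\<close> by 0 or
    a full period of \<open>h\<close>.\<close>
  have alt: "\<eta> z = h (Arg (- z) + pi)" if "z \<noteq> 0" for z
    using Arg_minus[OF that] hper[of "Arg z"] by (auto simp: \<eta>_def algebra_simps)
  have "continuous_on (sphere 0 1) \<eta>"
    unfolding continuous_on_eq_continuous_within
  proof
    fix z :: complex assume z: "z \<in> sphere 0 1"
    show "continuous (at z within sphere 0 1) \<eta>"
    proof (cases "z \<in> \<real>\<^sub>\<le>\<^sub>0")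
      case False
      then have "isCont \<eta> z" unfolding \<eta>_def using continuous_at_Arg ch isCont_o2 by blast
      then show ?thesis by (rule continuous_at_imp_continuous_within)
    next
      case True
      have z0: "z \<noteq> 0" using z by auto
      have "- z \<notin> \<real>\<^sub>\<le>\<^sub>0" using True z0 by (auto simp: complex_nonpos_Reals_iff complex_eq_iff)
      then have "isCont (\<lambda>z. Arg (- z)) z"
        using isCont_o2[of z uminus Arg] continuous_at_Arg by (simp add: isCont_minus)
      then have "isCont (\<lambda>z. h (Arg (- z) + pi)) z"
        using isCont_o2[of z "\<lambda>z. Arg (- z) + pi" h] ch by (simp add: isCont_add)
      then have "continuous (at z within sphere 0 1) (\<lambda>z. h (Arg (- z) + pi))"
        by (rule continuous_at_imp_continuous_within)
      then show ?thesis
        by (rule continuous_transform_within[where \<delta> = 1]) (use z in simp_all, metis alt norm_zero zero_neq_one)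
    qed
  qed
  moreover have "f z = z powi n * cis (\<eta> z)" if "z \<in> sphere 0 1" for z
  proof -
    have "z \<noteq> 0" using that by auto
    then have z: "z = cis (Arg z)" using that by (simp add: cis_Arg sgn_div_norm)
    have "f z = cis (L (Arg z))" using L[of "Arg z"] z by simp
    also have "\<dots> = cis (of_int n * Arg z) * cis (\<eta> z)" by (simp add: cis_mult \<eta>_def h_def)
    also have "cis (of_int n * Arg z) = z powi n" by (subst (2) z) (simp add: cis_power_int)
    finally show ?thesis .
  qed
  ultimately show thesis using that by blast
qed

text \<open>
  If \<open>a\<close> is scaled down to 0, the map \<open>z \<mapsto> r (cis (a z), b z)\<close> becomes \<open>r (1, b z)\<close>; so the degree of \<open>b\<close>
  times the degree of \<open>r (1, \<cdot>)\<close> is 1.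
\<close>

lemma circle_map_with_retraction:
  assumes a: "continuous_on (sphere 0 1) a" and b: "continuous_on (sphere 0 1) b" "b ` sphere 0 1 \<subseteq> sphere 0 1"
    and r: "continuous_on (sphere 0 1 \<times> sphere 0 1) r" "r ` (sphere 0 1 \<times> sphere 0 1) \<subseteq> sphere 0 1"
    and rab: "\<And>z. z \<in> sphere 0 1 \<Longrightarrow> r (cis (a z), b z) = z"
  obtains \<eta> where "continuous_on (sphere 0 1) \<eta>"
    "(\<forall>z\<in>sphere 0 1. b z = z * cis (\<eta> z)) \<or> (\<forall>z\<in>sphere 0 1. b z = cnj z * cis (\<eta> z))"
proof -
  let ?S = "sphere (0::complex) 1"
  obtain d :: int and \<beta> where \<beta>: "continuous_on ?S \<beta>" "\<forall>z\<in>?S. b z = z powi d * cis (\<beta> z)"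
    by (rule circle_map_degree[OF b])
  have r1: "continuous_on ?S (\<lambda>y. r (1, y))"
    by (rule continuous_on_compose2[OF r(1)]) (auto intro!: continuous_intros)
  have r1S: "(\<lambda>y. r (1, y)) ` ?S \<subseteq> ?S"
    by (rule image_subsetI, rule subsetD[OF r(2)], rule imageI) simp
  obtain d' :: int and \<beta>' where \<beta>': "continuous_on ?S \<beta>'" "\<forall>z\<in>?S. r (1, z) = z powi d' * cis (\<beta>' z)"
    by (rule circle_map_degree[OF r1 r1S])
  have bS: "b z \<in> ?S" if "z \<in> ?S" for z using b(2) that by blast
  define h where "h = (\<lambda>(s::real, z). r (cis (s * a z), b z))"
  have "continuous_on ({0..1} \<times> ?S) h"
    unfolding h_def case_prod_unfold
  proof (rule continuous_on_compose2[OF r(1)])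
    have "continuous_on ({0..1::real} \<times> ?S) (\<lambda>x. a (snd x))" "continuous_on ({0..1::real} \<times> ?S) (\<lambda>x. b (snd x))"
      by (rule continuous_on_compose2[OF a] continuous_on_compose2[OF b(1)]; auto intro: continuous_intros)+
    then show "continuous_on ({0..1} \<times> ?S) (\<lambda>x. (cis (fst x * a (snd x)), b (snd x)))"
      by (intro continuous_intros continuous_on_cis_real)
    show "(\<lambda>x. (cis (fst x * a (snd x)), b (snd x))) ` ({0..1} \<times> ?S) \<subseteq> ?S \<times> ?S"
      using bS by auto
  qed
  moreover have "h ` ({0..1} \<times> ?S) \<subseteq> ?S"
  proof (rule image_subsetI)
    fix p assume "p \<in> {0..1::real} \<times> ?S"
    then show "h p \<in> ?S" unfolding h_def case_prod_unfold
      by (intro subsetD[OF r(2)] imageI) (use bS in auto)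
  qed
  ultimately have "homotopic_with_canon (\<lambda>x. True) ?S ?S (\<lambda>z. r (1, b z)) (\<lambda>z. r (cis (a z), b z))"
    unfolding homotopic_with_def
    by (intro exI[of _ h]) (auto simp: h_def image_subset_iff_funcset)
  \<comment> \<open>The quotient of homotopic circle maps is inessential, so it has a continuous
    argument \<open>\<gamma>\<close>.\<close>
  from iffD1[OF homotopic_circlemaps_divide this]
  have "\<exists>c. homotopic_with_canon (\<lambda>h. True) ?S ?S (\<lambda>z. r (1, b z) / r (cis (a z), b z)) (\<lambda>x. c)"
    by (elim conjE)
  then obtain \<gamma> where \<gamma>: "continuous_on ?S \<gamma>"
      "\<And>z. z \<in> ?S \<Longrightarrow> r (1, b z) / r (cis (a z), b z) = exp (\<i> * of_real (\<gamma> z))"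
    unfolding inessential_eq_continuous_logarithm_circle by blast
  let ?\<theta> = "\<lambda>z. \<gamma> z - of_int d' * \<beta> z - \<beta>' (b z)"
  have "continuous_on ?S (\<lambda>z. \<beta>' (b z))"
    by (rule continuous_on_compose2[OF \<beta>'(1) b])
  then have "continuous_on ?S ?\<theta>" by (intro continuous_intros \<gamma> \<beta>)
  \<comment> \<open>Insert both normal forms: \<open>r (1, b z)\<close> is
    \<open>z powi (d * d')\<close> up to a factor with continuous argument, and
    \<open>r (cis (a z), b z)\<close> is \<open>z\<close>.\<close>
  moreover have "z powi (d * d' - 1) = cis (?\<theta> z)" if z: "z \<in> ?S" for z
  proof -
    have z0: "z \<noteq> 0" using z by auto
    have "z powi (d * d') * cis (of_int d' * \<beta> z) * cis (\<beta>' (b z)) = z * cis (\<gamma> z)"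
      using \<gamma>(2)[OF z, unfolded rab[OF z]] bspec[OF \<beta>'(2) bS[OF z]] bspec[OF \<beta>(2) z] z0
      by (simp add: power_int_mult_distrib power_int_mult[symmetric] cis_power_int cis_conv_exp[symmetric] field_simps)
    then have *: "z powi (d * d') * cis (of_int d' * \<beta> z + \<beta>' (b z)) = z * cis (\<gamma> z)"
      by (simp add: cis_mult mult.assoc)
    have "z powi (d * d') = z powi (d * d') * cis (of_int d' * \<beta> z + \<beta>' (b z))
        * cis (- (of_int d' * \<beta> z + \<beta>' (b z)))"
      by (simp only: mult.assoc cis_mult) simp
    also have "\<dots> = z * cis (?\<theta> z)"
      unfolding * by (simp add: cis_mult mult.assoc algebra_simps)
    finally have "z powi (d * d') = z * cis (?\<theta> z)" .
    then show ?thesis using z0 by (simp add: power_int_diff)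
  qed
  ultimately have "d * d' - 1 = 0" using circle_power_eq_cis by blast
  then have "d = 1 \<or> d = -1" using zmult_eq_1_iff[of d d'] by auto
  then have "(\<forall>z\<in>?S. b z = z * cis (\<beta> z)) \<or> (\<forall>z\<in>?S. b z = cnj z * cis (\<beta> z))"
  proof
    assume "d = 1" then show ?thesis using \<beta>(2) by simp
  next
    have "z powi (-1) = cnj z" if "z \<in> ?S" for z
      using that complex_div_cnj[of 1 z] by (simp add: power_int_minus inverse_eq_divide)
    moreover assume "d = -1"
    ultimately show ?thesis using \<beta>(2) by simp
  qed
  with \<beta>(1) show thesis by (rule that)
qed

text \<open>
  A zero of the difference of disk and path, in the cylinder \<open>D\<^sup>2 \<times> [-N, N]\<close>.  After a rotation of the
  horizontal component by \<open>\<eta>\<close>, extended to the disk, the difference points outward on the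
  boundary of the cylinder.
\<close>

lemma disk_meets_line:
  fixes a \<kappa> :: "_ \<Rightarrow> real" and b e :: "_ \<Rightarrow> complex"
  assumes a: "continuous_on (cball (0::complex) 1) a" and b: "continuous_on (cball 0 1) b"
    and \<eta>: "continuous_on (sphere 0 1) \<eta>" "\<And>z. z \<in> sphere 0 1 \<Longrightarrow> b z = z * cis (\<eta> z)"
    and \<kappa>: "continuous_on UNIV \<kappa>" and e: "continuous_on UNIV e" "\<And>t::real. norm (e t) \<le> 1"
    and N: "0 \<le> N" "\<And>z. z \<in> cball 0 1 \<Longrightarrow> \<kappa> (- N) < a z" "\<And>z. z \<in> cball 0 1 \<Longrightarrow> a z < \<kappa> N"
  obtains z t where "z \<in> cball 0 1" "a z = \<kappa> t" "b z = e t"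
proof -
  obtain \<eta>' where \<eta>': "continuous_on (cball 0 1) \<eta>'" "\<And>z. z \<in> sphere 0 1 \<Longrightarrow> \<eta>' z = \<eta> z"
    using Tietze_unbounded[OF \<eta>(1), of "cball 0 1"] by (auto simp: closed_subset)
  let ?C = "cball (0::complex) 1 \<times> {-N..N}"
  define F where "F p = (cis (- \<eta>' (fst p)) * (b (fst p) - e (snd p)), \<kappa> (snd p) - a (fst p))" for p
  have c1: "continuous_on ?C (\<lambda>p. a (fst p))" "continuous_on ?C (\<lambda>p. b (fst p))" "continuous_on ?C (\<lambda>p. \<eta>' (fst p))"
    by (rule continuous_on_compose2[OF a] continuous_on_compose2[OF b] continuous_on_compose2[OF \<eta>'(1)];
        auto intro: continuous_intros)+
  have c2: "continuous_on ?C (\<lambda>p. \<kappa> (snd p))" "continuous_on ?C (\<lambda>p. e (snd p))"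
    by (rule continuous_on_compose2[OF \<kappa>] continuous_on_compose2[OF e(1)]; auto intro: continuous_intros)+
  have "continuous_on ?C (\<lambda>p. cis (- \<eta>' (fst p)))"
    by (intro continuous_on_cis_real continuous_intros c1)
  then have F: "continuous_on ?C F" unfolding F_def by (intro continuous_intros c1 c2)
  have C: "convex ?C" "closed ?C" "compact ?C" "?C \<noteq> {}" using N(1)
    by (auto intro: convex_Times closed_Times compact_Times)
  have "continuous_on ?C (\<lambda>p. closest_point ?C (p - F p))"
    by (intro continuous_on_compose2[OF continuous_on_closest_point[OF C(1,2,4), of UNIV]] continuous_intros F) auto
  moreover have "(\<lambda>p. closest_point ?C (p - F p)) \<in> ?C \<rightarrow> ?C"
    using closest_point_in_set[OF C(2,4)] by blast
  ultimately obtain p where p: "p \<in> ?C" "closest_point ?C (p - F p) = p"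
    using brouwer[OF C(3,1,4)] by blast
  obtain z t where zt: "p = (z, t)" by (cases p)
  define f g where "f = cis (- \<eta>' z) * (b z - e t)" and "g = \<kappa> t - a z"
  have z: "norm z \<le> 1" and t: "- N \<le> t" "t \<le> N" using p(1) zt by auto
  have ineq: "0 \<le> f \<bullet> (x - z) + g * (s - t)" if "x \<in> cball 0 1" "s \<in> {-N..N}" for x s
    using closest_point_dot[OF C(1,2), of "(x, s)" "p - F p"] that p(2)
    by (simp add: zt F_def f_def g_def inner_diff_right algebra_simps)
  \<comment> \<open>A nonzero \<open>g\<close> would force \<open>t\<close> to an end of the
    cylinder, where the sign of \<open>g\<close> is the opposite one.\<close>
  have "g = 0"
  proof (rule ccontr)
    assume "g \<noteq> 0"
    then consider "g > 0" | "g < 0" by linarith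
    then show False
    proof cases
      case 1
      then have "0 \<le> g * (- N - t)" using ineq[of z "- N"] z N(1) by simp
      then have "t = - N" using 1 t by (simp add: zero_le_mult_iff)
      then show False using N(2)[of z] z 1 by (simp add: g_def)
    next
      case 2
      then have "0 \<le> g * (N - t)" using ineq[of z N] z N(1) by simp
      then have "t = N" using 2 t by (simp add: zero_le_mult_iff)
      then show False using N(3)[of z] z 2 by (simp add: g_def)
    qed
  qed
  moreover have "f = 0"
  proof (rule ccontr)
    assume f0: "f \<noteq> 0"
    \<comment> \<open>The unit vector opposite to \<open>f\<close> is the best test point: by
      Cauchy-Schwarz it forces \<open>z\<close> onto the circle. There
      \<open>f = z - cis (- \<eta> z) * e t\<close> with \<open>norm (e t) \<le> 1\<close> has
      \<open>f \<bullet> z \<ge> 0\<close>, a contradiction.\<close>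
    have "0 \<le> f \<bullet> (- sgn f - z)" using ineq[of "- sgn f" t] t f0 by (simp add: norm_sgn)
    moreover have "f \<bullet> sgn f = norm f" using f0 by (simp add: sgn_div_norm dot_square_norm power2_eq_square)
    ultimately have 1: "f \<bullet> z \<le> - norm f" by (simp add: inner_diff_right)
    moreover have "\<bar>f \<bullet> z\<bar> \<le> norm f * norm z" by (rule Cauchy_Schwarz_ineq2)
    ultimately have "norm f \<le> norm f * norm z" by linarith
    then have "1 \<le> norm z" using f0 mult_le_cancel_left_pos[of "norm f" 1 "norm z"] by simp
    then have nz: "norm z = 1" using z by simp
    then have "f = z - cis (- \<eta> z) * e t"
      using \<eta>(2)[of z] \<eta>'(2)[of z] by (simp add: f_def algebra_simps) (simp add: cis_mult flip: mult.assoc)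
    then have "f \<bullet> z = 1 - (cis (- \<eta> z) * e t) \<bullet> z" using nz by (simp add: inner_diff_left dot_square_norm)
    moreover have "(cis (- \<eta> z) * e t) \<bullet> z \<le> norm (cis (- \<eta> z) * e t) * norm z" by (rule norm_cauchy_schwarz)
    ultimately have "f \<bullet> z \<ge> 0" using e(2)[of t] nz by (simp add: norm_mult)
    moreover have "norm f > 0" using f0 by simp
    ultimately show False using 1 by linarith
  qed
  ultimately show thesis using that[of z t] z by (auto simp: f_def g_def)
qed

text \<open>
  Multiplying the circle factor by the positive reals gives an open subset of \<open>\<complex> \<times> \<complex>\<close>, to which
  invariance of domain applies.
\<close>

lemma solid_torus_interior_invariant:
  fixes f :: "complex \<times> complex \<Rightarrow> complex \<times> complex"
  assumes f: "continuous_on (sphere 0 1 \<times> cball 0 1) f" "inj_on f (sphere 0 1 \<times> cball 0 1)"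
    "f ` (sphere 0 1 \<times> cball 0 1) \<subseteq> sphere 0 1 \<times> cball 0 1"
    and p: "p \<in> sphere 0 1 \<times> ball 0 1"
  shows "f p \<in> sphere 0 1 \<times> ball 0 1"
proof -
  let ?T = "sphere (0::complex) 1 \<times> cball (0::complex) 1"
  define q where "q = (\<lambda>p::complex\<times>complex. (sgn (fst p), snd p))"
  define F where "F = (\<lambda>p. (of_real (norm (fst p)) * fst (f (q p)), snd (f (q p))))"
  let ?U = "(- {0::complex}) \<times> ball (0::complex) 1"
  have q: "q p \<in> ?T" if "p \<in> ?U" for p using that by (simp add: q_def norm_sgn mem_Times_iff)
  have fT: "f (q p) \<in> ?T" if "p \<in> ?U" for p by (rule subsetD[OF f(3) imageI[OF q[OF that]]])
  have nF: "norm (fst (F p)) = norm (fst p)" if "p \<in> ?U" for p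
    using fT[OF that] by (simp add: F_def norm_mult mem_Times_iff)
  have "continuous_on ?U q"
    unfolding q_def sgn_div_norm by (intro continuous_intros) (simp add: mem_Times_iff)
  then have "continuous_on ?U (\<lambda>p. f (q p))"
    by (rule continuous_on_compose2[OF f(1)]) (rule image_subsetI, erule q)
  then have cont: "continuous_on ?U F"
    unfolding F_def by (intro continuous_intros)
  have inj: "inj_on F ?U"
  proof (rule inj_onI)
    fix x y assume xy: "x \<in> ?U" "y \<in> ?U" "F x = F y"
    have n: "norm (fst x) = norm (fst y)" using nF xy by metis
    moreover have "norm (fst x) \<noteq> 0" using xy(1) by (simp add: mem_Times_iff)
    ultimately have "f (q x) = f (q y)" using xy(3) by (simp add: F_def prod_eq_iff)
    then have "q x = q y" by (rule inj_onD[OF f(2) _ q[OF xy(1)] q[OF xy(2)]])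
    then have "sgn (fst x) = sgn (fst y)" "snd x = snd y" by (simp_all add: q_def)
    moreover have "fst x = norm (fst x) *\<^sub>R sgn (fst x)" "fst y = norm (fst y) *\<^sub>R sgn (fst y)"
      using xy(1,2) by (simp_all add: sgn_div_norm mem_Times_iff)
    ultimately show "x = y" using n by (metis prod_eq_iff)
  qed
  have "open (F ` ?U)" by (rule invariance_of_domain[OF cont _ inj]) (auto intro: open_Times)
  moreover have "F ` ?U \<subseteq> UNIV \<times> cball 0 1" 
    by (rule image_subsetI) (use fT in \<open>simp add: F_def mem_Times_iff\<close>)
  ultimately have "F ` ?U \<subseteq> interior (UNIV \<times> cball 0 1)" by (rule interior_maximal[rotated])
  then have "F ` ?U \<subseteq> UNIV \<times> ball 0 1" by (simp add: interior_Times)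
  moreover have pU: "p \<in> ?U" using p by (auto simp: mem_Times_iff)
  moreover have qp: "q p = p" using p by (simp add: q_def sgn_div_norm mem_Times_iff)
  ultimately have "F p \<in> UNIV \<times> ball 0 1" by blast
  then have "snd (f p) \<in> ball 0 1" by (simp add: F_def qp mem_Times_iff)
  moreover have "f p \<in> ?T" using fT[OF pU] qp by simp
  ultimately show ?thesis by (simp add: mem_Times_iff)
qed

section \<open>A criterion for geometric essentiality\<close>

text \<open>A loop of degree \<open>n\<close> unrolls to a path whose height
  \<open>n * t + \<eta> (cis t)\<close> is unbounded in both directions, so it has to pass the disk
  \<open>(a, b)\<close> lifted to the universal cover.\<close>

lemma disk_meets_loop:
  fixes a :: "complex \<Rightarrow> real" and n :: int
  assumes a: "continuous_on (cball 0 1) a" and b: "continuous_on (cball 0 1) b"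
    and \<beta>: "continuous_on (sphere 0 1) \<beta>"
      "(\<forall>z\<in>sphere 0 1. b z = z * cis (\<beta> z)) \<or> (\<forall>z\<in>sphere 0 1. b z = cnj z * cis (\<beta> z))"
    and \<eta>: "continuous_on (sphere 0 1) \<eta>" and e: "continuous_on (sphere 0 1) e" "\<And>z. z \<in> sphere 0 1 \<Longrightarrow> norm (e z) \<le> 1"
    and n: "n \<noteq> 0"
  obtains z t where "z \<in> cball 0 1" "a z = of_int n * t + \<eta> (cis t)" "b z = e (cis t)"
proof -
  let ?D = "cball (0::complex) 1" and ?S = "sphere (0::complex) 1"
  \<comment> \<open>Reparametrizing the disk by the identity or by \<open>cnj\<close> reduces
    boundary degree -1 to degree 1.\<close>
  obtain \<iota> :: "complex \<Rightarrow> complex" where \<iota>: "continuous_on ?D \<iota>" "\<iota> ` ?D \<subseteq> ?D" "\<iota> ` ?S \<subseteq> ?S"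
    and b\<iota>: "\<forall>z\<in>?S. b (\<iota> z) = z * cis (\<beta> (\<iota> z))"
    using \<beta>(2)
  proof
    assume "\<forall>z\<in>?S. b z = z * cis (\<beta> z)"
    then show thesis by (intro that[of "\<lambda>z. z"]) (auto intro: continuous_intros)
  next
    assume *: "\<forall>z\<in>?S. b z = cnj z * cis (\<beta> z)"
    show thesis
    proof (rule that[of cnj])
      show "\<forall>z\<in>?S. b (cnj z) = z * cis (\<beta> (cnj z))" using * by simp
    qed (auto intro: continuous_intros)
  qed
  have a\<iota>: "continuous_on ?D (\<lambda>z. a (\<iota> z))" by (rule continuous_on_compose2[OF a \<iota>(1,2)])
  have b\<iota>c: "continuous_on ?D (\<lambda>z. b (\<iota> z))" by (rule continuous_on_compose2[OF b \<iota>(1,2)])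
  have \<beta>\<iota>: "continuous_on ?S (\<lambda>z. \<beta> (\<iota> z))"
    by (rule continuous_on_compose2[OF \<beta>(1) continuous_on_subset[OF \<iota>(1)] \<iota>(3)]) (rule sphere_cball)
  \<comment> \<open>For negative \<open>n\<close> the path is run backwards, so that it always
    rises.\<close>
  define \<sigma> :: real where "\<sigma> = sgn (of_int n)"
  have \<sigma>: "of_int n * \<sigma> \<ge> 1"
  proof -
    have "of_int n * \<sigma> = \<bar>of_int n\<bar>" unfolding \<sigma>_def by (rule abs_sgn[symmetric])
    moreover have "\<bar>n\<bar> \<ge> 1" using n by simp
    ultimately show ?thesis by (metis of_int_1_le_iff of_int_abs)
  qed
  define \<kappa> where "\<kappa> t = of_int n * (\<sigma> * t) + \<eta> (cis (\<sigma> * t))" for t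
  have cisS: "continuous_on UNIV (\<lambda>t. cis (\<sigma> * t))"
    by (intro continuous_on_cis_real continuous_intros)
  have "continuous_on UNIV (\<lambda>t. \<eta> (cis (\<sigma> * t)))"
    by (rule continuous_on_compose2[OF \<eta> cisS]) (simp add: image_subset_iff)
  then have c\<kappa>: "continuous_on UNIV \<kappa>" unfolding \<kappa>_def by (intro continuous_intros)
  have ce: "continuous_on UNIV (\<lambda>t. e (cis (\<sigma> * t)))"
    by (rule continuous_on_compose2[OF e(1) cisS]) (simp add: image_subset_iff)
  have "bounded (a ` ?D)" by (intro compact_imp_bounded compact_continuous_image a compact_cball)
  then obtain A where A: "\<forall>x\<in>a ` ?D. norm x \<le> A" unfolding bounded_iff by (rule exE)
  have "bounded (\<eta> ` ?S)" by (intro compact_imp_bounded compact_continuous_image \<eta> compact_sphere)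
  then obtain B where B: "\<forall>x\<in>\<eta> ` ?S. norm x \<le> B" unfolding bounded_iff by (rule exE)
  \<comment> \<open>At times \<open>- N\<close> and \<open>N\<close> the path is below and above all
    heights of the disk: it has climbed at least \<open>N\<close>, up to an error \<open>B\<close>,
    and the heights are bounded by \<open>A\<close>.\<close>
  define N where "N = \<bar>A\<bar> + \<bar>B\<bar> + 1"
  have nN: "of_int n * (\<sigma> * N) \<ge> N"
  proof -
    have "N \<ge> 0" by (simp add: N_def)
    then have "1 * N \<le> (of_int n * \<sigma>) * N" using \<sigma> by (rule mult_right_mono[rotated])
    then show ?thesis by (simp add: mult.assoc)
  qed
  have \<eta>B: "\<bar>\<eta> (cis s)\<bar> \<le> B" for s using B by simp
  have aA: "\<bar>a (\<iota> z)\<bar> \<le> A" if "z \<in> ?D" for z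
    using A \<iota>(2) that by (metis imageI real_norm_def subsetD)
  have N1: "\<kappa> (- N) < a (\<iota> z)" if "z \<in> ?D" for z
  proof -
    have "of_int n * (\<sigma> * - N) \<le> - N" using nN by simp
    then show ?thesis
      using \<eta>B[of "\<sigma> * - N"] aA[OF that] abs_ge_self[of A] abs_ge_self[of B]
      unfolding \<kappa>_def abs_le_iff N_def by linarith
  qed
  have N2: "a (\<iota> z) < \<kappa> N" if "z \<in> ?D" for z
    using nN \<eta>B[of "\<sigma> * N"] aA[OF that] abs_ge_self[of A] abs_ge_self[of B]
    unfolding \<kappa>_def abs_le_iff N_def by linarith
  obtain z t where "z \<in> ?D" "a (\<iota> z) = \<kappa> t" "b (\<iota> z) = e (cis (\<sigma> * t))"
  proof (rule disk_meets_line[OF a\<iota> b\<iota>c \<beta>\<iota> _ c\<kappa> ce])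
    show "b (\<iota> z) = z * cis (\<beta> (\<iota> z))" if "z \<in> ?S" for z using b\<iota> that by (rule bspec)
    show "norm (e (cis (\<sigma> * t))) \<le> 1" for t by (rule e(2)) simp
    show "0 \<le> N" by (simp add: N_def)
    show "\<kappa> (- N) < a (\<iota> z)" if "z \<in> ?D" for z using that by (rule N1)
    show "a (\<iota> z) < \<kappa> N" if "z \<in> ?D" for z using that by (rule N2)
  qed
  moreover have "\<iota> z \<in> ?D" by (rule subsetD[OF \<iota>(2) imageI[OF \<open>z \<in> ?D\<close>]])
  ultimately show thesis using that[of "\<iota> z" "\<sigma> * t"] by (simp add: \<kappa>_def)
qed

lemma framing_facts:
  assumes "framing V \<phi>"
  shows "continuous_on std_solid_torus \<phi>" "continuous_on V (inv_into std_solid_torus \<phi>)"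
    "\<And>p. p \<in> std_solid_torus \<Longrightarrow> \<phi> p \<in> V"
    "\<And>x. x \<in> V \<Longrightarrow> inv_into std_solid_torus \<phi> x \<in> std_solid_torus"
    "\<And>p. p \<in> std_solid_torus \<Longrightarrow> inv_into std_solid_torus \<phi> (\<phi> p) = p"
    "\<And>x. x \<in> V \<Longrightarrow> \<phi> (inv_into std_solid_torus \<phi> x) = x"
proof -
  have b: "bij_betw \<phi> std_solid_torus V" and s: "smooth_on std_solid_torus \<phi>" "smooth_on V (inv_into std_solid_torus \<phi>)"
    using assms unfolding framing_def diffeomorphism_def by simp_all
  show "continuous_on std_solid_torus \<phi>" "continuous_on V (inv_into std_solid_torus \<phi>)"
    using s by (simp_all add: smooth_on_imp_continuous_on)
  show "\<And>p. p \<in> std_solid_torus \<Longrightarrow> \<phi> p \<in> V"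
    using b by (rule bij_betw_apply)
  show "\<And>x. x \<in> V \<Longrightarrow> inv_into std_solid_torus \<phi> x \<in> std_solid_torus"
    using bij_betw_inv_into[OF b] by (rule bij_betw_apply)
  show "\<And>p. p \<in> std_solid_torus \<Longrightarrow> inv_into std_solid_torus \<phi> (\<phi> p) = p"
    using b by (rule bij_betw_inv_into_left)
  show "\<And>x. x \<in> V \<Longrightarrow> \<phi> (inv_into std_solid_torus \<phi> x) = x"
    using b by (rule bij_betw_inv_into_right)
qed

lemma framing_change_interior:
  assumes \<phi>: "framing V \<phi>" and \<psi>: "framing V \<psi>" and p: "p \<in> sphere 0 1 \<times> ball 0 1"
  shows "inv_into std_solid_torus \<psi> (\<phi> p) \<in> sphere 0 1 \<times> ball 0 1"
proof (rule solid_torus_interior_invariant[where f = "\<lambda>p. inv_into std_solid_torus \<psi> (\<phi> p)", OF _ _ _ p])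
  note F = framing_facts[OF \<phi>] and G = framing_facts[OF \<psi>]
  let ?T = "sphere (0::complex) 1 \<times> cball (0::complex) 1"
  have im: "\<phi> ` std_solid_torus \<subseteq> V" by (rule image_subsetI) (rule F(3))
  show "continuous_on ?T (\<lambda>p. inv_into std_solid_torus \<psi> (\<phi> p))"
    using continuous_on_compose2[OF G(2) F(1) im] by (simp add: std_solid_torus_def)
  show "inj_on (\<lambda>p. inv_into std_solid_torus \<psi> (\<phi> p)) ?T"
    unfolding std_solid_torus_def[symmetric] by (rule inj_onI) (metis F(3,5) G(6))
  show "(\<lambda>p. inv_into std_solid_torus \<psi> (\<phi> p)) ` ?T \<subseteq> ?T"
    unfolding std_solid_torus_def[symmetric] by (rule image_subsetI) (intro G(4) F(3))
qed

text \<open>A boundary point sent to the interior would be returned to the interior by the opposite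
  change of framing.\<close>

lemma framing_change_boundary:
  assumes \<phi>: "framing V \<phi>" and \<psi>: "framing V \<psi>" and p: "p \<in> sphere 0 1 \<times> sphere 0 1"
  shows "inv_into std_solid_torus \<psi> (\<phi> p) \<in> sphere 0 1 \<times> sphere 0 1"
proof -
  note F = framing_facts[OF \<phi>] and G = framing_facts[OF \<psi>]
  let ?q = "inv_into std_solid_torus \<psi> (\<phi> p)"
  have pT: "p \<in> std_solid_torus" using p by (auto simp: std_solid_torus_def)
  then have q: "?q \<in> std_solid_torus" by (intro G(4) F(3))
  have "?q \<notin> sphere 0 1 \<times> ball 0 1"
  proof
    assume "?q \<in> sphere 0 1 \<times> ball 0 1"
    then have "inv_into std_solid_torus \<phi> (\<psi> ?q) \<in> sphere 0 1 \<times> ball 0 1"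
      by (rule framing_change_interior[OF \<psi> \<phi>])
    moreover have "inv_into std_solid_torus \<phi> (\<psi> ?q) = p" using pT by (simp add: G(6) F(3,5))
    ultimately show False using p by auto
  qed
  with q show ?thesis by (simp add: std_solid_torus_def mem_Times_iff)
qed

text \<open>
  The boundary of a meridional disk is a meridian for some framing \<open>\<psi>\<close>, possibly different from \<open>\<phi>\<close>.
  The angle of \<open>\<psi>\<close> along this meridian yields the map \<open>r\<close> that forces degree \<open>1\<close> or \<open>-1\<close>
  for the angle of \<open>\<phi>\<close>.
\<close>

lemma geometrically_essential_if_no_logarithm:
  assumes \<phi>: "framing V \<phi>" and k: "continuous_on (sphere 0 1) k" "k ` sphere 0 1 \<subseteq> V"
    and nolog: "\<nexists>\<eta>. continuous_on (sphere (0::complex) 1) \<eta> \<and>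
      (\<forall>z\<in>sphere 0 1. fst (inv_into std_solid_torus \<phi> (k z)) = cis (\<eta> z))"
  shows "geometrically_essential V (k ` sphere 0 1)"
  unfolding geometrically_essential_def
proof (intro allI impI)
  fix D assume "meridional_disk V D"
  then obtain g where g: "smooth_embedding (cball 0 1) V g" "D = g ` cball (0::complex) 1" "meridian V (g ` sphere 0 1)"
    unfolding meridional_disk_def by (elim exE conjE)
  from g(3) obtain \<psi> p where \<psi>: "framing V \<psi>" and p: "p \<in> sphere 0 1" and J: "g ` sphere 0 1 = \<psi> ` ({p} \<times> sphere 0 1)"
    unfolding meridian_def by (elim exE conjE)
  let ?S = "sphere (0::complex) 1" and ?D = "cball (0::complex) 1" and ?T = "std_solid_torus"
  define h where "h = inv_into ?T \<phi>"
  define h' where "h' = inv_into ?T \<psi>"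
  define g' where "g' = inv_into ?D g"
  note F = framing_facts[OF \<phi>, folded h_def] and G = framing_facts[OF \<psi>, folded h'_def]
  have gV: "g ` ?D \<subseteq> V" and gb: "bij_betw g ?D (g ` ?D)"
    and gs: "smooth_on ?D g" "smooth_on (g ` ?D) g'"
    using g(1) unfolding smooth_embedding_def diffeomorphism_def g'_def by simp_all
  have gc: "continuous_on ?D g" "continuous_on (g ` ?D) g'"
    using gs by (simp_all add: smooth_on_imp_continuous_on)
  have hg: "continuous_on ?D (\<lambda>z. h (g z))" by (rule continuous_on_compose2[OF F(2) gc(1) gV])
  have hk: "continuous_on ?S (\<lambda>z. h (k z))" by (rule continuous_on_compose2[OF F(2) k])
  have hgT: "h (g z) \<in> ?S \<times> ?D" if "z \<in> ?D" for z
    unfolding std_solid_torus_def[symmetric] by (rule F(4)[OF subsetD[OF gV imageI[OF that]]])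
  have hkT: "h (k z) \<in> ?S \<times> ?D" if "z \<in> ?S" for z
    unfolding std_solid_torus_def[symmetric] by (rule F(4)[OF subsetD[OF k(2) imageI[OF that]]])
  have SD: "z \<in> ?D" if "z \<in> ?S" for z using that by simp
  define b where "b z = snd (h (g z))" for z
  have bc: "continuous_on ?D b" unfolding b_def by (intro continuous_intros hg)
  have ac: "continuous_on ?D (\<lambda>z. fst (h (g z)))" by (intro continuous_intros hg)
  have an: "norm (fst (h (g z))) = 1" if "z \<in> ?D" for z using hgT[OF that] by (simp add: mem_Times_iff)
  have a0: "fst (h (g z)) \<noteq> 0" if "z \<in> ?D" for z using an[OF that] by auto
  \<comment> \<open>The disk is contractible, so its angle lifts: \<open>(a, b)\<close> is the disk
    in the universal cover.\<close>
  obtain l where l: "continuous_on ?D l" "\<And>z. z \<in> ?D \<Longrightarrow> fst (h (g z)) = exp (l z)"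
    using continuous_logarithm_on_cball[OF ac a0] by metis
  define a where "a z = Im (l z)" for z
  have a: "continuous_on ?D a" unfolding a_def by (intro continuous_intros l)
  have acis: "fst (h (g z)) = cis (a z)" if "z \<in> ?D" for z
  proof -
    have "exp (Re (l z)) = 1" using an[OF that] l(2)[OF that] by simp
    then show ?thesis using l(2)[OF that] by (simp add: a_def exp_eq_polar)
  qed
  have \<psi>g: "\<exists>y\<in>?S. g z = \<psi> (p, y)" if "z \<in> ?S" for z
  proof -
    have "g z \<in> \<psi> ` ({p} \<times> ?S)" unfolding J[symmetric] using that by (rule imageI)
    then show ?thesis by auto
  qed
  have hb: "h (g z) \<in> ?S \<times> ?S" if z: "z \<in> ?S" for z
  proof -
    obtain y where "y \<in> ?S" "g z = \<psi> (p, y)" using \<psi>g[OF z] by (rule bexE)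
    then show ?thesis using framing_change_boundary[OF \<psi> \<phi>, of "(p, y)"] p by (simp add: h_def)
  qed
  \<comment> \<open>Defined on the whole boundary torus: read off the \<open>\<psi>\<close>-angle,
    go to the meridian at \<open>p\<close>, and return to the parameter circle of the disk. On the
    boundary of the disk this undoes \<open>h (g z)\<close>.\<close>
  define r where "r x = g' (\<psi> (p, snd (h' (\<phi> x))))" for x
  have rpt: "snd (h' (\<phi> x)) \<in> ?S" if "x \<in> ?S \<times> ?S" for x
    using framing_change_boundary[OF \<phi> \<psi> that] by (simp add: h'_def mem_Times_iff)
  have SST: "?S \<times> ?S \<subseteq> ?T" by (auto simp: std_solid_torus_def)
  have g'\<psi>: "\<exists>z\<in>?S. \<psi> (p, y) = g z" if "y \<in> ?S" for y
  proof -
    have "\<psi> (p, y) \<in> g ` ?S" unfolding J using that by blast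
    then show ?thesis by auto
  qed
  have g'g: "g' (g z) = z" if "z \<in> ?D" for z
    unfolding g'_def using gb that by (rule bij_betw_inv_into_left)
  have rS: "r ` (?S \<times> ?S) \<subseteq> ?S"
  proof (rule image_subsetI)
    fix x assume "x \<in> ?S \<times> ?S"
    then obtain z where "z \<in> ?S" "\<psi> (p, snd (h' (\<phi> x))) = g z" using g'\<psi>[OF rpt] by blast
    then show "r x \<in> ?S" using g'g[OF SD] by (simp add: r_def)
  qed
  have rc: "continuous_on (?S \<times> ?S) r"
    unfolding r_def
  proof (rule continuous_on_compose2[OF gc(2)])
    have "\<phi> ` (?S \<times> ?S) \<subseteq> V" by (rule image_subsetI) (rule F(3)[OF subsetD[OF SST]])
    then have "continuous_on (?S \<times> ?S) (\<lambda>x. h' (\<phi> x))"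
      by (rule continuous_on_compose2[OF G(2) continuous_on_subset[OF F(1) SST]])
    then have *: "continuous_on (?S \<times> ?S) (\<lambda>x. (p, snd (h' (\<phi> x))))" by (intro continuous_intros)
    show "continuous_on (?S \<times> ?S) (\<lambda>x. \<psi> (p, snd (h' (\<phi> x))))"
      by (rule continuous_on_compose2[OF G(1) *], rule image_subsetI, rule subsetD[OF SST]) (use rpt p in simp)
    show "(\<lambda>x. \<psi> (p, snd (h' (\<phi> x)))) ` (?S \<times> ?S) \<subseteq> g ` ?D"
    proof (rule image_subsetI)
      fix x assume "x \<in> ?S \<times> ?S"
      then obtain z where "z \<in> ?S" "\<psi> (p, snd (h' (\<phi> x))) = g z" using g'\<psi>[OF rpt] by blast
      then show "\<psi> (p, snd (h' (\<phi> x))) \<in> g ` ?D" using SD by simp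
    qed
  qed
  have rab: "r (cis (a z), b z) = z" if z: "z \<in> ?S" for z
  proof -
    have "(cis (a z), b z) = h (g z)" using acis[OF SD[OF z]] by (simp add: b_def prod_eq_iff)
    moreover have "\<phi> (h (g z)) = g z" by (rule F(6)[OF subsetD[OF gV imageI[OF SD[OF z]]]])
    moreover obtain y where y: "y \<in> ?S" "g z = \<psi> (p, y)" using \<psi>g[OF z] by (rule bexE)
    moreover have "h' (\<psi> (p, y)) = (p, y)" by (rule G(5)[OF subsetD[OF SST]]) (use y p in simp)
    ultimately show ?thesis using g'g[OF SD[OF z]] by (simp add: r_def)
  qed
  have bS: "b ` ?S \<subseteq> ?S" by (rule image_subsetI) (use hb in \<open>simp add: b_def mem_Times_iff\<close>)
  obtain \<beta> where \<beta>: "continuous_on ?S \<beta>"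
    "(\<forall>z\<in>?S. b z = z * cis (\<beta> z)) \<or> (\<forall>z\<in>?S. b z = cnj z * cis (\<beta> z))"
    by (rule circle_map_with_retraction[OF continuous_on_subset[OF a sphere_cball]
          continuous_on_subset[OF bc sphere_cball] bS rc rS rab])
  have "continuous_on ?S (\<lambda>z. fst (h (k z)))" by (intro continuous_intros hk)
  moreover have "(\<lambda>z. fst (h (k z))) ` ?S \<subseteq> ?S"
    by (rule image_subsetI) (use hkT in \<open>simp add: mem_Times_iff\<close>)
  ultimately obtain n \<eta> where n: "continuous_on ?S \<eta>" "\<forall>z\<in>?S. fst (h (k z)) = z powi n * cis (\<eta> z)"
    by (rule circle_map_degree)
  have "n \<noteq> 0" using nolog n unfolding h_def[symmetric] by auto
  have "continuous_on ?S (\<lambda>z. snd (h (k z)))" by (intro continuous_intros hk)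
  moreover have "norm (snd (h (k z))) \<le> 1" if "z \<in> ?S" for z using hkT[OF that] by (simp add: mem_Times_iff)
  ultimately obtain z t where zt: "z \<in> ?D" "a z = of_int n * t + \<eta> (cis t)" "b z = snd (h (k (cis t)))"
    by (rule disk_meets_loop[OF a bc \<beta> n(1) _ _ \<open>n \<noteq> 0\<close>])
  have ct: "cis t \<in> ?S" by simp
  have "fst (h (k (cis t))) = cis (a z)"
    using bspec[OF n(2) ct] by (simp add: zt(2) cis_power_int cis_mult)
  \<comment> \<open>Equal heights in the universal cover give equal angles downstairs.\<close>
  then have "h (g z) = h (k (cis t))" using acis[OF zt(1)] zt(3) by (simp add: b_def prod_eq_iff)
  then have "\<phi> (h (g z)) = \<phi> (h (k (cis t)))" by simp
  then have "g z = k (cis t)"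
    using F(6)[OF subsetD[OF gV imageI[OF zt(1)]]] F(6)[OF subsetD[OF k(2) imageI[OF ct]]] by simp
  then have "g z \<in> D \<inter> k ` ?S" using zt(1) g(2) ct by (metis IntI imageI)
  then show "D \<inter> k ` ?S \<noteq> {}" by blast
qed

section \<open>A generic line through a point of the knot\<close>

text \<open>Once per period \<open>\<rho>\<close> crosses the negative half-axis, upwards, so it
  winds once clockwise and its square twice; a periodic argument \<open>\<theta>\<close> of the
  square would mean winding number 0.\<close>

lemma no_logarithm_of_crossing:
  fixes \<rho> :: "real \<Rightarrow> complex" and \<theta> :: "real \<Rightarrow> real"
  assumes \<rho>: "continuous_on UNIV \<rho>" "\<And>t. \<rho> (t + 2 * pi) = \<rho> t" "\<And>t. \<rho> t \<noteq> 0"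
    and \<theta>: "continuous_on UNIV \<theta>" "\<And>t. \<theta> (t + 2 * pi) = \<theta> t"
    and sq: "\<And>t. (\<rho> t)\<^sup>2 = of_real ((norm (\<rho> t))\<^sup>2) * cis (\<theta> t)"
    and t0: "\<rho> t0 = -1" and away: "\<And>t. t0 < t \<Longrightarrow> t < t0 + 2 * pi \<Longrightarrow> \<rho> t \<notin> \<real>\<^sub>\<le>\<^sub>0"
    and \<delta>: "0 < \<delta>" and right: "\<And>t. t0 < t \<Longrightarrow> t < t0 + \<delta> \<Longrightarrow> 0 < Im (\<rho> t)"
    and left: "\<And>t. t0 - \<delta> < t \<Longrightarrow> t < t0 \<Longrightarrow> Im (\<rho> t) < 0"
  shows False
proof -
  define d where "d t = (2 * Arg (\<rho> t) - \<theta> t) / (2 * pi)" for t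
  have polar: "cis (2 * Arg (\<rho> t)) = cis (\<theta> t)" for t
  proof -
    have "\<rho> t = of_real (norm (\<rho> t)) * cis (Arg (\<rho> t))" using rcis_cmod_Arg[of "\<rho> t"] by (simp add: rcis_def)
    then have "(\<rho> t)\<^sup>2 = of_real ((norm (\<rho> t))\<^sup>2) * (cis (Arg (\<rho> t)))\<^sup>2"
      by (metis of_real_power power_mult_distrib)
    also have "(cis (Arg (\<rho> t)))\<^sup>2 = cis (2 * Arg (\<rho> t))" by (simp add: power2_eq_square cis_mult)
    finally show ?thesis using sq[of t] \<rho>(3)[of t] by simp
  qed
  let ?I = "{t0<..<t0 + 2 * pi}"
  have dI: "d t \<in> \<int>" for t unfolding d_def by (rule cis_eq_cis_imp_Ints[OF polar])
  have "continuous_on ?I d"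
    unfolding d_def
    by (intro continuous_intros continuous_on_subset[OF \<rho>(1)] continuous_on_subset[OF \<theta>(1)]) (use away in auto)
  then have dc: "d s = d t" if "s \<in> ?I" "t \<in> ?I" for s t
    using that dI by (intro real_Ints_constant[of ?I]) auto
  define k where "k = d (t0 + pi)"
  have dk: "d t = k" if "t \<in> ?I" for t unfolding k_def using that by (rule dc) simp
  \<comment> \<open>\<open>Arg (- \<rho> t)\<close> is continuous at \<open>t0\<close>, where
    \<open>Arg (\<rho> t)\<close> jumps. The constant \<open>d\<close> on the period after
    \<open>t0\<close> fixes \<open>E\<close> on the right and, by periodicity, on the left; the two
    values differ by \<open>4 * pi\<close>.\<close>
  define E where "E t = 2 * Arg (- \<rho> t) - \<theta> t" for t
  have "isCont \<rho> t0" using \<rho>(1) by (simp add: continuous_on_eq_continuous_at)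
  then have "isCont (\<lambda>t. - \<rho> t) t0" by (rule isCont_minus)
  moreover have "isCont Arg (- \<rho> t0)" by (rule continuous_at_Arg) (simp add: t0)
  ultimately have "isCont (\<lambda>t. Arg (- \<rho> t)) t0" by (rule isCont_o2)
  moreover have "isCont \<theta> t0" using \<theta>(1) by (simp add: continuous_on_eq_continuous_at)
  ultimately have "isCont E t0" unfolding E_def by (intro continuous_intros)
  then have E: "(E \<longlongrightarrow> E t0) (at_right t0)" "(E \<longlongrightarrow> E t0) (at_left t0)"
    unfolding isCont_def by (simp_all add: filterlim_at_split)
  have per: "d (t + 2 * pi) = d t" for t by (simp add: d_def \<rho>(2) \<theta>(2))
  have r: "E t = 2 * pi * k - 2 * pi" if t: "t0 < t" "t < t0 + min \<delta> pi" for t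
  proof -
    have "0 < Im (\<rho> t)" using t by (intro right) auto
    then have "Arg (- \<rho> t) < 0" "\<rho> t \<noteq> 0" using \<rho>(3) by (simp_all add: Arg_neg_iff)
    then have "Arg (\<rho> t) = Arg (- \<rho> t) + pi" using Arg_minus[of "- \<rho> t"] by simp
    moreover have "d t = k" using t by (intro dk) (auto simp: min_def split: if_splits)
    ultimately show ?thesis by (simp add: E_def d_def field_simps)
  qed
  have l: "E t = 2 * pi * k + 2 * pi" if t: "t0 - min \<delta> pi < t" "t < t0" for t
  proof -
    have "Im (\<rho> t) < 0" using t by (intro left) auto
    then have "0 < Arg (- \<rho> t)" "\<rho> t \<noteq> 0" using \<rho>(3) Arg_pos_iff[of "- \<rho> t"] by auto
    then have "Arg (\<rho> t) = Arg (- \<rho> t) - pi" using Arg_minus[of "- \<rho> t"] by simp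
    moreover have "d (t + 2 * pi) = k" using t by (intro dk) (auto simp: min_def split: if_splits)
    ultimately show ?thesis unfolding per by (simp add: E_def d_def field_simps)
  qed
  have m: "0 < min \<delta> pi" using \<delta> by simp
  have "\<forall>\<^sub>F t in at_right t0. E t = 2 * pi * k - 2 * pi"
    unfolding eventually_at_right_field using r m by (intro exI[of _ "t0 + min \<delta> pi"]) simp
  then have "(E \<longlongrightarrow> 2 * pi * k - 2 * pi) (at_right t0)" by (rule tendsto_eventually)
  with E(1) have 1: "E t0 = 2 * pi * k - 2 * pi" using tendsto_unique trivial_limit_at_right_real by blast
  have "\<forall>\<^sub>F t in at_left t0. E t = 2 * pi * k + 2 * pi"
    unfolding eventually_at_left_field using l m by (intro exI[of _ "t0 - min \<delta> pi"]) simp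
  then have "(E \<longlongrightarrow> 2 * pi * k + 2 * pi) (at_left t0)" by (rule tendsto_eventually)
  with E(2) have "E t0 = 2 * pi * k + 2 * pi" using tendsto_unique trivial_limit_at_left_real by blast
  with 1 show False by simp
qed

lemma proj_pt_mult_vec: "proj_pt x *v y = (x \<bullet> y) *\<^sub>R x"
  by (simp add: vec_eq_iff proj_pt_def matrix_vector_mult_def inner_vec_def sum_4 algebra_simps)

lemma RP3_unit:
  assumes "A \<in> RP3" obtains x where "norm x = 1" "A = proj_pt x"
  using assms unfolding RP3_def by auto

lemma differentiable_compose_at:
  "f differentiable (at x) \<Longrightarrow> g differentiable (at (f x)) \<Longrightarrow> (\<lambda>x. g (f x)) differentiable (at x)"
  using differentiable_chain_at[of f x g] by (simp add: o_def)

lemma smooth_circle_differentiable: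
  fixes f :: "complex \<Rightarrow> 'a::euclidean_space"
  assumes "smooth_on (sphere 0 1) f" shows "(\<lambda>t. f (cis t)) differentiable (at t)"
proof -
  have "cis t \<in> sphere 0 1" by simp
  obtain U F where U: "open U" "cis t \<in> U" "\<forall>k. Ck_on k F U" "\<forall>y\<in>U \<inter> sphere 0 1. F y = f y"
    by (rule smooth_onE[OF assms \<open>cis t \<in> sphere 0 1\<close>])
  have "Ck_on (Suc 0) F U" using U(3) by (rule spec)
  then have F: "F differentiable (at (cis t))" using U(2) by simp
  have "(cis has_vector_derivative (\<i> * cis t)) (at t)"
    unfolding cis_conv_exp[abs_def]
    by (rule has_vector_derivative_real_field) (auto intro!: derivative_eq_intros)
  then have cis: "cis differentiable (at t)"
    using has_vector_derivative_def differentiable_def by blast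
  have "(\<lambda>t. F (cis t)) differentiable (at t)"
    using differentiable_compose_at[OF cis F] .
  then obtain F' where F': "((\<lambda>t. F (cis t)) has_derivative F') (at t)" by (auto simp: differentiable_def)
  have "open (cis -` U)"
    by (rule open_vimage[OF U(1) continuous_on_cis_real]) (rule continuous_on_id)
  then have "((\<lambda>t. f (cis t)) has_derivative F') (at t)"
    by (rule has_derivative_transform_within_open[OF F']) (use U in auto)
  then show ?thesis by (auto simp: differentiable_def)
qed

text \<open>\<open>D *v x0\<close> is the velocity of a unit lift of the curve. Differentiating
  symmetry, trace 1 and idempotence of the projections \<open>A t\<close> constrains
  \<open>D\<close>; if \<open>x0\<close> were an eigenvector with eigenvalue \<open>l\<close>, then
  \<open>D = 2 l x0 x0\<^sup>T\<close>, and trace 0 would give \<open>D = 0\<close>.\<close>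

lemma nonradial_derivative:
  assumes A: "\<And>t. A t \<in> RP3" "(A has_vector_derivative D) (at t0)" and x0: "A t0 = proj_pt x0" "norm x0 = 1"
    and D: "D \<noteq> 0"
  shows "D *v x0 \<notin> span {x0}"
proof
  assume "D *v x0 \<in> span {x0}"
  then obtain l where l: "D *v x0 = l *\<^sub>R x0" by (auto simp: span_singleton)
  have tr: "(\<lambda>t. transpose (A t)) = A" "(\<lambda>t. trace (A t)) = (\<lambda>t. 1)" "(\<lambda>t. A t ** A t) = A"
  proof -
    have *: "transpose (A t) = A t \<and> trace (A t) = 1 \<and> A t ** A t = A t" for t
    proof -
      obtain x where x: "norm x = 1" "A t = proj_pt x" using RP3_unit[OF A(1)] by blast
      have "proj_pt x ** proj_pt x = (x \<bullet> x) *\<^sub>R proj_pt x"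
        by (simp add: vec_eq_iff proj_pt_def matrix_matrix_mult_def inner_vec_def sum_4 algebra_simps)
      moreover have "transpose (proj_pt x) = proj_pt x" by (simp add: proj_pt_def transpose_def vec_eq_iff mult.commute)
      ultimately show ?thesis using x by (simp add: trace_proj_pt dot_square_norm)
    qed
    then show "(\<lambda>t. transpose (A t)) = A" "(\<lambda>t. trace (A t)) = (\<lambda>t. 1)" "(\<lambda>t. A t ** A t) = A" by auto
  qed
  have 1: "transpose D = D"
    using bounded_linear.has_vector_derivative[OF bounded_linear_transpose A(2)] A(2)
    unfolding tr by (rule vector_derivative_unique_at)
  have 2: "trace D = 0"
    using bounded_linear.has_vector_derivative[OF bounded_linear_trace A(2)] has_vector_derivative_const
    unfolding tr by (rule vector_derivative_unique_at)
  have 3: "A t0 ** D + D ** A t0 = D"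
    using bounded_bilinear.has_vector_derivative[OF bounded_bilinear_matrix_mult A(2) A(2)] A(2)
    unfolding tr by (rule vector_derivative_unique_at)
  have "(D ** proj_pt x0) $ i $ j = (D *v x0) $ i * x0 $ j" for i j
    by (simp add: matrix_matrix_mult_def matrix_vector_mult_def proj_pt_def sum_4 algebra_simps)
  then have 4: "D ** A t0 = l *\<^sub>R proj_pt x0"
    unfolding x0(1) l by (simp add: vec_eq_iff proj_pt_def)
  have "A t0 ** D = transpose (D ** A t0)"
    using 1 fun_cong[OF tr(1), of t0] by (simp add: matrix_transpose_mul)
  also have "\<dots> = l *\<^sub>R proj_pt x0"
    unfolding 4 by (simp add: transpose_def proj_pt_def vec_eq_iff mult.commute)
  finally have D2: "D = (2 * l) *\<^sub>R proj_pt x0" using 3 4 by (simp add: scaleR_2 flip: scaleR_scaleR)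
  then have "trace D = 2 * l" using x0(2) by (simp add: trace_scaleR trace_proj_pt dot_square_norm)
  then show False using 2 D D2 by simp
qed

text \<open>A velocity vanishing everywhere would make the parametrization constant, against
  injectivity.\<close>

lemma knot_nonradial_point:
  assumes f: "smooth_embedding (sphere 0 1) RP3 f"
  obtains t0 x0 D where "((\<lambda>t. f (cis t)) has_vector_derivative D) (at t0)" "f (cis t0) = proj_pt x0"
    "norm x0 = 1" "D *v x0 \<notin> span {x0}"
proof -
  have sm: "smooth_on (sphere 0 1) f" and inj: "inj_on f (sphere 0 1)" and im: "f ` sphere 0 1 \<subseteq> RP3"
    using f unfolding smooth_embedding_def diffeomorphism_def bij_betw_def by simp_all
  define A where "A t = f (cis t)" for t
  have AR: "A t \<in> RP3" for t unfolding A_def by (rule subsetD[OF im imageI]) simp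
  have dA: "(A has_vector_derivative vector_derivative A (at t)) (at t)" for t
    using smooth_circle_differentiable[OF sm, of t] unfolding A_def[abs_def] by (simp add: vector_derivative_works)
  have "\<exists>t. vector_derivative A (at t) \<noteq> 0"
  proof (rule ccontr)
    assume "\<nexists>t. vector_derivative A (at t) \<noteq> 0"
    then have z: "(A has_vector_derivative 0) (at t)" for t using dA[of t] by simp
    have "\<exists>c. \<forall>t\<in>UNIV. A t = c"
      by (rule has_vector_derivative_zero_constant[of UNIV A]) (use z in auto)
    then have "f (cis 0) = f (cis pi)" unfolding A_def by (metis UNIV_I)
    then have "cis 0 = cis pi" by (rule inj_onD[OF inj]) simp_all
    then show False by simp
  qed
  then obtain t0 where t0: "vector_derivative A (at t0) \<noteq> 0" by blast
  obtain x0 where x0: "norm x0 = 1" "A t0 = proj_pt x0" using RP3_unit[OF AR] by blast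
  show thesis
  proof (rule that)
    show "((\<lambda>t. f (cis t)) has_vector_derivative vector_derivative A (at t0)) (at t0)"
      using dA[of t0] unfolding A_def[abs_def] .
    show "f (cis t0) = proj_pt x0" using x0 by (simp add: A_def)
    show "vector_derivative A (at t0) *v x0 \<notin> span {x0}"
      by (rule nonradial_derivative[OF AR dA x0(2,1) t0])
  qed (rule x0)
qed

text \<open>The line is spanned by \<open>x0\<close> and a second vector \<open>y\<close>, and
  \<open>g\<close> sends these to the third and fourth axis. The vectors \<open>y\<close> to be
  avoided are the plane of \<open>x0\<close> and \<open>d\<close> (tangency) and the cone joining
  \<open>x0\<close> to the knot (further intersections); both are negligible.\<close>

lemma knot_generic_coordinates:
  assumes f: "smooth_embedding (sphere 0 1) RP3 f"
    and x0: "f (cis t0) = proj_pt x0" "norm x0 = 1" and d: "d \<notin> span {x0}"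
  obtains g :: "real^4 \<Rightarrow> real^4"
  where "linear g" "inj g" "g x0 = axis 3 1" "g d $ 1 \<noteq> 0 \<or> g d $ 2 \<noteq> 0"
    "\<forall>t x. norm x = 1 \<longrightarrow> f (cis t) = proj_pt x \<longrightarrow> g x $ 1 = 0 \<longrightarrow> g x $ 2 = 0 \<longrightarrow> cis t = cis t0"
proof -
  have sm: "smooth_on (sphere 0 1) f" and inj: "inj_on f (sphere 0 1)"
    using f unfolding smooth_embedding_def diffeomorphism_def bij_betw_def by simp_all
  \<comment> \<open>Column \<open>j\<close> of \<open>x x\<^sup>T\<close> is a multiple of
    \<open>x\<close>, nonzero if \<open>x $ j\<close> is. So the maps \<open>G j\<close> cover all
    combinations of \<open>x0\<close> and points of the knot without a choice of lifts, with 3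
    parameters in dimension 4.\<close>
  define G where "G j = (\<lambda>p::real\<times>real\<times>real. fst p *\<^sub>R x0 + fst (snd p) *\<^sub>R (f (cis (snd (snd p))) *v axis j 1))"
    for j :: 4
  have neg: "negligible (range (G j))" for j
  proof (rule negligible_differentiable_image_lowdim)
    have A: "(\<lambda>p::real\<times>real\<times>real. f (cis (snd (snd p)))) differentiable (at p)" for p
      by (rule differentiable_compose_at[where f = "\<lambda>p. snd (snd p)" and g = "\<lambda>t. f (cis t)"])
        (auto intro: smooth_circle_differentiable[OF sm] bounded_linear_imp_differentiable
          bounded_linear_snd_comp bounded_linear_snd)
    have L: "bounded_linear (\<lambda>A::real^4^4. A *v axis j 1)"
      unfolding linear_conv_bounded_linear[symmetric]
      by (auto intro!: linearI simp: matrix_vector_mult_add_rdistrib scaleR_matrix_vector_assoc)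
    have B: "(\<lambda>p::real\<times>real\<times>real. f (cis (snd (snd p))) *v axis j 1) differentiable (at p)" for p
      using differentiable_compose_at[OF A bounded_linear_imp_differentiable[OF L]] .
    have l: "(\<lambda>p::real\<times>real\<times>real. fst p) differentiable (at p)" "(\<lambda>p::real\<times>real\<times>real. fst (snd p)) differentiable (at p)" for p
      by (rule bounded_linear_imp_differentiable, rule bounded_linear_fst,
          rule bounded_linear_imp_differentiable, rule bounded_linear_fst_comp, rule bounded_linear_snd)
    have "G j differentiable (at p)" for p
      unfolding G_def
      by (rule differentiable_add[OF differentiable_scaleR[OF l(1) differentiable_const] differentiable_scaleR[OF l(2) B]])
    then show "G j differentiable_on UNIV" by (simp add: differentiable_on_def)
  qed simp
  have "dim (span {x0, d}) \<le> card {x0, d}" by (simp only: dim_span) (rule dim_le_card', simp)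
  also have "card {x0, d} \<le> 2" by (simp add: card_insert_if)
  finally have "dim (span {x0, d}) < DIM(real^4)" by simp
  then have "negligible (span {x0, d})" by (rule negligible_lowdim)
  moreover have "negligible (\<Union>(range (\<lambda>j. range (G j))))"
    by (rule negligible_Union) (use neg in auto)
  ultimately have "negligible (span {x0, d} \<union> \<Union>(range (\<lambda>j. range (G j))))" (is "negligible ?X")
    by (rule negligible_Un)
  then have "?X \<noteq> UNIV" using non_negligible_UNIV by metis
  then obtain y where "y \<notin> ?X" by blast
  then have y: "y \<notin> span {x0, d}" "\<And>j p. y \<noteq> G j p" by auto
  have x00: "x0 \<noteq> 0" using x0 by auto
  have yx: "y \<notin> span {x0}" using y(1) span_mono[of "{x0}" "{x0, d}"] by auto
  have ind: "independent {y, x0}" using x00 yx by (simp add: independent_insert dependent_single)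
  have "y \<noteq> x0" using yx span_base by auto
  define h :: "real^4 \<Rightarrow> real^4" where "h v = (if v = x0 then axis 3 1 else axis 4 1)" for v
  have h: "h x0 = axis 3 1" "h y = axis 4 1" using \<open>y \<noteq> x0\<close> by (simp_all add: h_def)
  have "independent (h ` {y, x0})"
    unfolding image_insert image_empty h
    by (rule independent_mono[OF independent_Basis]) (auto simp: axis_in_Basis_iff)
  moreover have "inj_on h {y, x0}" using h by (simp add: inj_on_def axis_eq_axis)
  ultimately obtain g where g: "linear g" "inj g" "\<forall>x\<in>{y, x0}. g x = h x"
    using linear_independent_extend_inj[OF ind] by blast
  have gx: "g x0 = axis 3 1" "g y = axis 4 1" using g(3) h by simp_all
  have span: "x = g x $ 3 *\<^sub>R x0 + g x $ 4 *\<^sub>R y" if "g x $ 1 = 0" "g x $ 2 = 0" for x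
  proof (rule injD[OF g(2)])
    show "g x = g (g x $ 3 *\<^sub>R x0 + g x $ 4 *\<^sub>R y)"
      using that by (simp add: linear_add[OF g(1)] linear_cmul[OF g(1)] gx vec4_eq_iff axis_def)
  qed
  \<comment> \<open>With \<open>b\<close> nonzero the equation could be solved for \<open>y\<close>,
    which was chosen to exclude this.\<close>
  have yspan: "b = 0" if "v = a *\<^sub>R x0 + b *\<^sub>R y" "y \<noteq> inverse b *\<^sub>R v + (- (inverse b * a)) *\<^sub>R x0" for a b v
    using that by (cases "b = 0") (simp_all add: algebra_simps)
  show thesis
  proof (rule that[OF g(1,2) gx(1)])
    show "g d $ 1 \<noteq> 0 \<or> g d $ 2 \<noteq> 0"
    proof (rule ccontr)
      assume "\<not> ?thesis"
      then have eq: "d = g d $ 3 *\<^sub>R x0 + g d $ 4 *\<^sub>R y" by (intro span) auto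
      have "g d $ 4 = 0"
      proof (rule yspan[OF eq])
        have "inverse (g d $ 4) *\<^sub>R d + (- (inverse (g d $ 4) * g d $ 3)) *\<^sub>R x0 \<in> span {x0, d}"
          by (intro span_add span_scale span_base) auto
        then show "y \<noteq> inverse (g d $ 4) *\<^sub>R d + (- (inverse (g d $ 4) * g d $ 3)) *\<^sub>R x0" using y(1) by auto
      qed
      then have "d = g d $ 3 *\<^sub>R x0" using eq by simp
      also have "\<dots> \<in> span {x0}" by (intro span_scale span_base) simp
      finally show False using d by simp
    qed
    show "\<forall>t x. norm x = 1 \<longrightarrow> f (cis t) = proj_pt x \<longrightarrow> g x $ 1 = 0 \<longrightarrow> g x $ 2 = 0 \<longrightarrow> cis t = cis t0"
    proof (intro allI impI)
    fix t x assume x: "norm x = 1" "f (cis t) = proj_pt x" "g x $ 1 = 0" "g x $ 2 = 0"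
    note eq = span[OF x(3,4)]
    have "x \<noteq> 0" using x(1) by auto
    then obtain j where j: "x $ j \<noteq> 0" by (auto simp: vec_eq_iff)
    have "g x $ 4 = 0"
    proof (rule yspan[OF eq])
      have "f (cis t) *v axis j 1 = x $ j *\<^sub>R x" unfolding x(2) proj_pt_mult_vec by (simp add: inner_axis)
      then have "inverse (g x $ 4) *\<^sub>R x + (- (inverse (g x $ 4) * g x $ 3)) *\<^sub>R x0
          = G j (- (inverse (g x $ 4) * g x $ 3), inverse (g x $ 4) / x $ j, t)"
        using j by (simp add: G_def)
      then show "y \<noteq> inverse (g x $ 4) *\<^sub>R x + (- (inverse (g x $ 4) * g x $ 3)) *\<^sub>R x0" using y(2) by simp
    qed
    then have x': "x = g x $ 3 *\<^sub>R x0" using eq by simp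
    then have "norm x = \<bar>g x $ 3\<bar> * norm x0" by (metis norm_scaleR)
    then have "g x $ 3 = 1 \<or> g x $ 3 = - 1" using x(1) x0(2) by auto
    then have "x = x0 \<or> x = - x0" using x' by auto
    then have "f (cis t) = f (cis t0)" using x(2) x0(1) proj_pt_eq_iff by metis
    then show "cis t = cis t0" by (rule inj_onD[OF inj]) simp_all
    qed
  qed
qed

section \<open>Pushing the line off the knot\<close>

text \<open>
  The first two coordinates of \<open>g\<close> cut out the generic line through \<open>x\<^sub>0\<close>, and the third one is 1 at \<open>x\<^sub>0\<close>.
  With \<open>c\<close> the velocity of the knot at \<open>x\<^sub>0\<close> in the first two coordinates, the term \<open>s * \<i> * c\<close>
  pushes the line sideways, to one side for positive and to the other for negative \<open>s\<close>.
\<close>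

definition perturbed :: "(real^4 \<Rightarrow> real^4) \<Rightarrow> complex \<Rightarrow> real \<Rightarrow> real^4 \<Rightarrow> complex" where
  "perturbed g c s x = Complex (g x $ 1) (g x $ 2) + of_real (s * g x $ 3) * (\<i> * c)"

lemma cis_representative: "\<exists>t'. t0 - pi \<le> t' \<and> t' \<le> t0 + pi \<and> cis t' = cis t"
proof (intro exI conjI)
  let ?a = "Arg (cis (t - t0))"
  show "t0 - pi \<le> t0 + ?a" "t0 + ?a \<le> t0 + pi" using mpi_less_Arg[of "cis (t - t0)"] Arg_le_pi[of "cis (t - t0)"] by linarith+
  have "cis (t0 + ?a) = cis t0 * cis ?a" by (simp add: cis_mult)
  also have "cis ?a = cis (t - t0)" by (simp add: cis_Arg sgn_div_norm)
  finally show "cis (t0 + ?a) = cis t" by (simp add: cis_mult)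
qed

lemma cis_neq_cis:
  assumes "t \<noteq> t0" "\<bar>t - t0\<bar> < 2 * pi" shows "cis t \<noteq> cis t0"
proof
  assume "cis t = cis t0"
  then have "(t - t0) / (2 * pi) \<in> \<int>" by (rule cis_eq_cis_imp_Ints)
  moreover have "(t - t0) / (2 * pi) \<noteq> 0" using assms(1) by simp
  ultimately have "1 \<le> \<bar>(t - t0) / (2 * pi)\<bar>" by (rule Ints_nonzero_abs_ge1)
  then show False using assms(2) by (simp add: abs_divide)
qed

text \<open>The imaginary part of the ratio of the two pushed forms has the sign of
  \<open>r * Re w\<close>; this decides the direction of the crossing.\<close>

lemma Im_crossing_ratio:
  fixes w :: complex and r :: real
  shows "Im ((w + of_real r * \<i>) / (w - of_real r * \<i>)) = 2 * r * Re w / ((Re w)\<^sup>2 + (Im w - r)\<^sup>2)"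
  by (simp add: Im_divide algebra_simps)

text \<open>All forms with parameter between \<open>- \<epsilon>\<close> and
  \<open>\<epsilon>\<close> are nonzero on the knot away from \<open>x\<^sub>0\<close>. A
  nonpositive value of the ratio makes one of them vanish, so it can only occur at
  \<open>x\<^sub>0\<close>.\<close>

lemma ex_perturbed_without_logarithm:
  assumes f: "smooth_embedding (sphere 0 1) RP3 f"
  obtains g c s where "linear g" "inj g"
    "\<forall>t x. norm x = 1 \<longrightarrow> f (cis t) = proj_pt x \<longrightarrow> perturbed g c s x \<noteq> 0"
    "\<nexists>\<eta>. continuous_on (sphere (0::complex) 1) \<eta> \<and> (\<forall>t x. norm x = 1 \<longrightarrow> f (cis t) = proj_pt x \<longrightarrow>
       (perturbed g c s x)\<^sup>2 = of_real ((norm (perturbed g c s x))\<^sup>2) * cis (\<eta> (cis t)))"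
proof -
  have sm: "smooth_on (sphere 0 1) f" and im: "f ` sphere 0 1 \<subseteq> RP3"
    using f unfolding smooth_embedding_def diffeomorphism_def by simp_all
  obtain t0 x0 D where D: "((\<lambda>t. f (cis t)) has_vector_derivative D) (at t0)"
    and x0: "f (cis t0) = proj_pt x0" "norm x0 = 1" and Dx: "D *v x0 \<notin> span {x0}"
    by (rule knot_nonradial_point[OF f])
  let ?d = "D *v x0"
  obtain g :: "real^4 \<Rightarrow> real^4" where g: "linear g" "inj g" "g x0 = axis 3 1" "g ?d $ 1 \<noteq> 0 \<or> g ?d $ 2 \<noteq> 0"
    and gW': "\<forall>t x. norm x = 1 \<longrightarrow> f (cis t) = proj_pt x \<longrightarrow> g x $ 1 = 0 \<longrightarrow> g x $ 2 = 0 \<longrightarrow> cis t = cis t0"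
    by (rule knot_generic_coordinates[OF f x0 Dx])
  note gW = gW'[rule_format]
  define z0 where "z0 x = Complex (g x $ 1) (g x $ 2)" for x
  define c where "c = z0 ?d"
  have c0: "c \<noteq> 0" using g(4) by (auto simp: c_def z0_def complex_eq_iff)
  have z0_scale: "z0 (k *\<^sub>R x) = of_real k * z0 x" for k x
    by (simp add: z0_def linear_cmul[OF g(1)] complex_eq_iff)
  have z0_add: "z0 (x + y) = z0 x + z0 y" for x y
    by (simp add: z0_def linear_add[OF g(1)] complex_eq_iff)
  have z0x0: "z0 x0 = 0" by (simp add: z0_def g(3) axis_def complex_eq_iff)
  have gx03: "g x0 $ 3 = 1" by (simp add: g(3))
  have rep: "\<exists>x. norm x = 1 \<and> f (cis t) = proj_pt x" for t
  proof -
    have "f (cis t) \<in> RP3" by (rule subsetD[OF im imageI]) simp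
    then show ?thesis using RP3_unit by metis
  qed
  have matg: "matrix g *v x = g x" for x
    using matrix_works[of g x] g(1) by (simp add: linear_matrix_vector_mul_eq)
  \<comment> \<open>Products of two coordinates of \<open>g x\<close> are insensitive to the sign of
    \<open>x\<close>, hence continuous along the knot.\<close>
  define C where "C t = matrix g ** f (cis t) ** transpose (matrix g)" for t
  have C: "C t $ i $ j = g x $ i * g x $ j" if "f (cis t) = proj_pt x" for t x i j
    unfolding C_def that conj_proj_pt matg
    by (simp add: proj_pt_def)
  have cf: "continuous_on UNIV (\<lambda>t. f (cis t))"
    by (rule continuous_on_sphere_cis[OF smooth_on_imp_continuous_on[OF sm]])
  have cC: "continuous_on S (\<lambda>t. C t $ i $ j)" for S i j
  proof -
    have "continuous_on UNIV C" unfolding C_def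
      by (intro bounded_bilinear.continuous_on[OF bounded_bilinear_matrix_mult] continuous_on_const cf)
    then show ?thesis by (intro continuous_intros) (rule continuous_on_subset, auto)
  qed
  \<comment> \<open>Component of \<open>z0\<close> in the direction of the velocity
    \<open>c\<close>, normalized so that \<open>W ?d = 1\<close>.\<close>
  define W where "W x = Re (z0 x / c)" for x
  have Wlin: "linear W"
    by (rule linearI) (simp_all add: W_def z0_add z0_scale add_divide_distrib flip: times_divide_eq_right)
  \<comment> \<open>\<open>f (cis t) *v x0 = (x \<bullet> x0) *\<^sub>R x\<close> is a continuous
    lift of the knot through \<open>x0\<close>, independent of the sign of \<open>x\<close>. Of this
    lift, \<open>\<phi>\<close> is the progress across the line, changing sign at \<open>t0\<close>,
    and \<open>\<mu>\<close> the third coordinate, positive near \<open>t0\<close>.\<close>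
  define \<phi> where "\<phi> t = W (f (cis t) *v x0)" for t
  define \<mu> where "\<mu> t = g (f (cis t) *v x0) $ 3" for t
  have mv: "bounded_linear (\<lambda>A::real^4^4. A *v x0)"
    unfolding linear_conv_bounded_linear[symmetric]
    by (auto intro!: linearI simp: matrix_vector_mult_add_rdistrib scaleR_matrix_vector_assoc)
  have "(\<phi> has_vector_derivative W ?d) (at t0)"
    unfolding \<phi>_def
    using bounded_linear.has_vector_derivative[OF linear_conv_bounded_linear[THEN iffD1, OF Wlin]
        bounded_linear.has_vector_derivative[OF mv D]] .
  moreover have "W ?d = 1" using c0 by (simp add: W_def c_def)
  ultimately have \<phi>': "DERIV \<phi> t0 :> 1" by (simp add: has_real_derivative_iff_has_vector_derivative)
  have Ax0: "f (cis t0) *v x0 = x0" using x0 by (simp add: proj_pt_mult_vec dot_square_norm)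
  have \<phi>0: "\<phi> t0 = 0" by (simp add: \<phi>_def Ax0 W_def z0x0)
  obtain \<delta>1 where \<delta>1: "\<delta>1 > 0" "\<And>h. 0 < h \<Longrightarrow> h < \<delta>1 \<Longrightarrow> 0 < \<phi> (t0 + h)"
    using DERIV_pos_inc_right[OF \<phi>'] \<phi>0 by auto
  obtain \<delta>2 where \<delta>2: "\<delta>2 > 0" "\<And>h. 0 < h \<Longrightarrow> h < \<delta>2 \<Longrightarrow> \<phi> (t0 - h) < 0"
    using DERIV_pos_inc_left[OF \<phi>'] \<phi>0 by auto
  have "continuous_on UNIV \<mu>"
  proof -
    have "bounded_linear (\<lambda>x. g x $ 3)"
      using bounded_linear_compose[OF bounded_linear_vec_nth linear_conv_bounded_linear[THEN iffD1, OF g(1)]] .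
    then show ?thesis unfolding \<mu>_def
      by (intro bounded_linear.continuous_on[of "\<lambda>x. g x $ 3"] bounded_linear.continuous_on[OF mv] cf)
  qed
  then have "open {t. 0 < \<mu> t}" by (intro open_Collect_less continuous_on_const)
  moreover have "t0 \<in> {t. 0 < \<mu> t}" by (simp add: \<mu>_def Ax0 gx03)
  ultimately obtain \<delta>3 where \<delta>3: "\<delta>3 > 0" "\<And>t. \<bar>t - t0\<bar> < \<delta>3 \<Longrightarrow> 0 < \<mu> t"
    using openE[of "{t. 0 < \<mu> t}" t0] by (auto simp: ball_def dist_real_def abs_minus_commute subset_iff)
  define \<delta> where "\<delta> = min (min \<delta>1 \<delta>2) (min \<delta>3 1)"
  have \<delta>: "0 < \<delta>" "\<delta> < pi" "\<delta> \<le> \<delta>1" "\<delta> \<le> \<delta>2" "\<delta> \<le> \<delta>3"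
    using \<delta>1(1) \<delta>2(1) \<delta>3(1) pi_gt3 by (auto simp: \<delta>_def)
  have \<phi>r: "0 < \<phi> t" if "t0 < t" "t < t0 + \<delta>" for t using \<delta>1(2)[of "t - t0"] \<delta> that by simp
  have \<phi>l: "\<phi> t < 0" if "t0 - \<delta> < t" "t < t0" for t using \<delta>2(2)[of "t0 - t"] \<delta> that by simp
  have \<phi>x: "\<phi> t = (x \<bullet> x0) * Re (z0 x / c)" "\<mu> t = (x \<bullet> x0) * g x $ 3" if "f (cis t) = proj_pt x" for t x
  proof -
    have "f (cis t) *v x0 = (x \<bullet> x0) *\<^sub>R x" unfolding that by (rule proj_pt_mult_vec)
    then show "\<phi> t = (x \<bullet> x0) * Re (z0 x / c)" "\<mu> t = (x \<bullet> x0) * g x $ 3"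
      by (simp_all add: \<phi>_def \<mu>_def W_def linear_cmul[OF Wlin, unfolded W_def] linear_cmul[OF g(1)])
  qed

  \<comment> \<open>How far the line may be pushed\<close>
  obtain B where B: "B > 0" "\<And>x. norm (g x) \<le> B * norm x" using linear_bounded_pos[OF g(1)] by blast
  \<comment> \<open>One period without a neighborhood of \<open>t0\<close>: there the knot keeps a
    distance \<open>r\<close> from the line, measured by \<open>z0\<close>.\<close>
  define K where "K = {t0 - pi..t0 - \<delta>} \<union> {t0 + \<delta>..t0 + pi}"
  have K: "compact K" "K \<noteq> {}" using \<delta> by (auto simp: K_def)
  have Kc: "continuous_on K (\<lambda>t. C t $ 1 $ 1 + C t $ 2 $ 2)" by (intro continuous_intros cC)
  obtain tm where tm: "tm \<in> K" "\<forall>t\<in>K. C tm $ 1 $ 1 + C tm $ 2 $ 2 \<le> C t $ 1 $ 1 + C t $ 2 $ 2"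
    using continuous_attains_inf[OF K Kc] by (rule bexE)
  have Cz: "C t $ 1 $ 1 + C t $ 2 $ 2 = (norm (z0 x))\<^sup>2" if "f (cis t) = proj_pt x" for t x
    unfolding cmod_power2 by (simp add: C[OF that] z0_def power2_eq_square)
  define r where "r = sqrt (C tm $ 1 $ 1 + C tm $ 2 $ 2)"
  have rz: "r \<le> norm (z0 x)" if "t \<in> K" "f (cis t) = proj_pt x" for t x
    unfolding r_def using bspec[OF tm(2) that(1)] Cz[OF that(2)] by (simp add: real_le_lsqrt)
  have r0: "r > 0"
  proof -
    obtain x where x: "norm x = 1" "f (cis tm) = proj_pt x" using rep by blast
    have "cis tm \<noteq> cis t0" using tm(1) \<delta> by (intro cis_neq_cis) (auto simp: K_def)
    then have "z0 x \<noteq> 0" using gW[OF x] by (auto simp: z0_def complex_eq_iff)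
    then show ?thesis unfolding r_def Cz[OF x(2)] by simp
  qed
  \<comment> \<open>The push changes the form on unit vectors by at most
    \<open>\<epsilon> * B * norm c = r / 2\<close>, so it creates no zero over
    \<open>K\<close>.\<close>
  define \<epsilon> where "\<epsilon> = r / (2 * norm c * B)"
  have \<epsilon>: "\<epsilon> > 0" using r0 c0 B(1) by (simp add: \<epsilon>_def)
  have away: "cis t = cis t0" if x: "norm x = 1" "f (cis t) = proj_pt x" and k: "\<bar>k\<bar> \<le> 1"
    and eq: "z0 x + of_real (k * \<epsilon> * g x $ 3) * (\<i> * c) = 0" for t x k
  proof -
    obtain t' where t': "t0 - pi \<le> t'" "t' \<le> t0 + pi" "cis t' = cis t" using cis_representative by blast
    have fx: "f (cis t') = proj_pt x" using t'(3) x(2) by simp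
    have zeq: "z0 x = - (of_real (k * \<epsilon> * g x $ 3) * (\<i> * c))" using eq by (simp add: eq_neg_iff_add_eq_0)
    show ?thesis
    proof (cases "t' \<in> K")
      case True
      have "norm (z0 x) = \<bar>k\<bar> * \<epsilon> * \<bar>g x $ 3\<bar> * norm c" using \<epsilon> by (simp add: zeq norm_mult abs_mult)
      also have "\<dots> \<le> 1 * \<epsilon> * B * norm c"
      proof (intro mult_mono k order_refl)
        show "\<bar>g x $ 3\<bar> \<le> B" using component_le_norm_cart[of "g x" 3] B(2)[of x] x(1) by simp
      qed (use \<epsilon> B(1) in auto)
      also have "\<dots> = r / 2" using c0 B(1) by (simp add: \<epsilon>_def)
      finally show ?thesis using rz[OF True fx] r0 by simp
    next
      case False
      \<comment> \<open>Near \<open>t0\<close> a zero of the pushed form makes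
        \<open>z0 x / c\<close> purely imaginary, because the push is orthogonal to
        \<open>c\<close>; so \<open>\<phi>\<close> vanishes, which happens only at
        \<open>t0\<close>.\<close>
      have "z0 x / c = - (of_real (k * \<epsilon> * g x $ 3) * \<i>)" using c0 by (simp add: zeq)
      then have "\<phi> t' = 0" by (simp add: \<phi>x(1)[OF fx])
      moreover have "t' = t0 \<or> (t0 < t' \<and> t' < t0 + \<delta>) \<or> (t0 - \<delta> < t' \<and> t' < t0)"
        using False t' by (auto simp: K_def)
      ultimately have "t' = t0" using \<phi>r[of t'] \<phi>l[of t'] by auto
      then show ?thesis using t'(3) by simp
    qed
  qed
  have pert: "perturbed g c s x = z0 x + of_real (s * g x $ 3) * (\<i> * c)" for s x
    by (simp add: perturbed_def z0_def)
  have nz: "perturbed g c s x \<noteq> 0" if s: "s = \<epsilon> \<or> s = - \<epsilon>" and x: "norm x = 1" "f (cis t) = proj_pt x" for s t x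
  proof
    assume z: "perturbed g c s x = 0"
    obtain k :: real where k: "s = k * \<epsilon>" "\<bar>k\<bar> \<le> 1" using s by (metis abs_minus_cancel abs_one mult_1 mult_minus1 order_refl)
    have "cis t = cis t0" by (rule away[OF x k(2)]) (use z k(1) in \<open>simp add: pert\<close>)
    then have "x = x0 \<or> x = - x0" using x(2) x0(1) proj_pt_eq_iff by metis
    then have "z0 x = 0" "\<bar>g x $ 3\<bar> = 1" using z0_scale[of "-1" x0] linear_cmul[OF g(1), of "-1" x0] z0x0 gx03 by auto
    then show False using z c0 s \<epsilon> by (auto simp: pert)
  qed

  \<comment> \<open>The ratio of the two pushed forms\<close>
  define Q where "Q t = Complex (C t $ 1 $ 1 - C t $ 2 $ 2) (2 * C t $ 1 $ 2)
      - 2 * (of_real \<epsilon> * \<i> * c) * Complex (C t $ 1 $ 3) (C t $ 2 $ 3)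
      - of_real (\<epsilon>\<^sup>2 * C t $ 3 $ 3) * c\<^sup>2" for t
  \<comment> \<open>The ratio is extended by its denominator, so that numerator and denominator are
    quadratic in \<open>x\<close> and thus continuous in \<open>t\<close>.\<close>
  define P where "P t = Complex (C t $ 1 $ 1 - C t $ 2 $ 2) (2 * C t $ 1 $ 2) + of_real (\<epsilon>\<^sup>2 * C t $ 3 $ 3) * c\<^sup>2" for t
  have PQ: "Q t = (perturbed g c (- \<epsilon>) x)\<^sup>2" "P t = perturbed g c \<epsilon> x * perturbed g c (- \<epsilon>) x"
    if "f (cis t) = proj_pt x" for t x
  proof -
    have 1: "Complex (C t $ 1 $ 1 - C t $ 2 $ 2) (2 * C t $ 1 $ 2) = (z0 x)\<^sup>2"
      by (simp add: C[OF that] z0_def complex_eq_iff power2_eq_square)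
    have 2: "Complex (C t $ 1 $ 3) (C t $ 2 $ 3) = z0 x * of_real (g x $ 3)"
      by (simp add: C[OF that] z0_def complex_eq_iff)
    have 3: "C t $ 3 $ 3 = (g x $ 3)\<^sup>2" by (simp add: C[OF that] power2_eq_square)
    have i: "\<i>\<^sup>2 = -1" by simp
    show "Q t = (perturbed g c (- \<epsilon>) x)\<^sup>2" unfolding Q_def 1 2 3 pert
      by (simp add: power2_eq_square algebra_simps)
    show "P t = perturbed g c \<epsilon> x * perturbed g c (- \<epsilon>) x" unfolding P_def 1 3 pert
      by (simp add: power2_eq_square algebra_simps)
  qed
  define \<rho> where "\<rho> t = P t / Q t" for t
  have \<rho>x: "\<rho> t = perturbed g c \<epsilon> x / perturbed g c (- \<epsilon>) x" "perturbed g c (- \<epsilon>) x \<noteq> 0" "perturbed g c \<epsilon> x \<noteq> 0"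
    if "norm x = 1" "f (cis t) = proj_pt x" for t x
    using nz[OF _ that, of \<epsilon>] nz[OF _ that, of "- \<epsilon>"] by (simp_all add: \<rho>_def PQ[OF that(2)] power2_eq_square)
  have Complex_eq': "Complex a b = of_real a + of_real b * \<i>" for a b by (simp add: complex_eq_iff)
  have Q0: "Q t \<noteq> 0" for t
  proof -
    obtain x where x: "norm x = 1" "f (cis t) = proj_pt x" using rep by blast
    show ?thesis using \<rho>x(2)[OF x] by (simp add: PQ(1)[OF x(2)])
  qed
  have "continuous_on UNIV \<rho>"
    unfolding \<rho>_def[abs_def]
  proof (rule continuous_on_divide)
    show "continuous_on UNIV P" "continuous_on UNIV Q"
      unfolding P_def[abs_def] Q_def[abs_def] Complex_eq'
      by (intro continuous_on_add continuous_on_diff continuous_on_mult continuous_on_of_real continuous_on_const cC)+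
  qed (use Q0 in simp)
  note \<rho>c = this
  let ?nolog = "\<lambda>s. \<nexists>\<eta>. continuous_on (sphere (0::complex) 1) \<eta> \<and> (\<forall>t x. norm x = 1 \<longrightarrow> f (cis t) = proj_pt x \<longrightarrow>
       (perturbed g c s x)\<^sup>2 = of_real ((norm (perturbed g c s x))\<^sup>2) * cis (\<eta> (cis t)))"
  have "?nolog \<epsilon> \<or> ?nolog (- \<epsilon>)"
  proof (rule ccontr)
    assume "\<not> (?nolog \<epsilon> \<or> ?nolog (- \<epsilon>))"
    then obtain \<eta>1 \<eta>2 where \<eta>1: "continuous_on (sphere 0 1) \<eta>1" "\<forall>t x. norm x = 1 \<longrightarrow> f (cis t) = proj_pt x \<longrightarrow>
       (perturbed g c \<epsilon> x)\<^sup>2 = of_real ((norm (perturbed g c \<epsilon> x))\<^sup>2) * cis (\<eta>1 (cis t))"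
      and \<eta>2: "continuous_on (sphere 0 1) \<eta>2" "\<forall>t x. norm x = 1 \<longrightarrow> f (cis t) = proj_pt x \<longrightarrow>
       (perturbed g c (- \<epsilon>) x)\<^sup>2 = of_real ((norm (perturbed g c (- \<epsilon>) x))\<^sup>2) * cis (\<eta>2 (cis t))"
      unfolding de_Morgan_disj not_not by (elim exE conjE)
    define \<theta> where "\<theta> t = \<eta>1 (cis t) - \<eta>2 (cis t)" for t
    have alg: "2 * (e * m) * a / R = 2 * e / (p\<^sup>2 * R) * (p * m * (p * a))" if "p \<noteq> 0" "R \<noteq> 0" for e m a R p :: real
      using that by (simp add: field_simps power2_eq_square)
    \<comment> \<open>Extending by the square of \<open>x \<bullet> x0\<close> turns the
      sign-dependent factors \<open>g x $ 3\<close> and \<open>Re (z0 x / c)\<close> into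
      \<open>\<mu> t\<close> and \<open>\<phi> t\<close>.\<close>
    have imr: "\<exists>k>0. Im (\<rho> t) = k * (\<mu> t * \<phi> t)" if t: "t0 - \<delta> < t" "t < t0 + \<delta>" "t \<noteq> t0" for t
    proof -
      obtain x where x: "norm x = 1" "f (cis t) = proj_pt x" using rep by blast
      define k where "k = 2 * \<epsilon> / ((x \<bullet> x0)\<^sup>2 * ((Re (z0 x / c))\<^sup>2 + (Im (z0 x / c) - \<epsilon> * g x $ 3)\<^sup>2))"
      have "\<phi> t \<noteq> 0" using \<phi>r[of t] \<phi>l[of t] t by (cases "t < t0") auto
      then have ne: "x \<bullet> x0 \<noteq> 0" "Re (z0 x / c) \<noteq> 0" unfolding \<phi>x[OF x(2)] by auto
      let ?w = "z0 x / c" and ?q = "\<epsilon> * g x $ 3"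
      have 1: "perturbed g c \<epsilon> x = c * (?w + of_real ?q * \<i>)" "perturbed g c (- \<epsilon>) x = c * (?w - of_real ?q * \<i>)"
        using c0 by (simp_all add: pert field_simps)
      have 2: "\<rho> t = (?w + of_real ?q * \<i>) / (?w - of_real ?q * \<i>)"
        unfolding \<rho>x(1)[OF x] 1 using c0 by simp
      have pos: "(Re ?w)\<^sup>2 + (Im ?w - ?q)\<^sup>2 > 0" using ne by (simp add: sum_power2_gt_zero_iff)
      have "Im (\<rho> t) = 2 * ?q * Re ?w / ((Re ?w)\<^sup>2 + (Im ?w - ?q)\<^sup>2)" unfolding 2 by (rule Im_crossing_ratio)
      also have "\<dots> = k * (\<mu> t * \<phi> t)"
        unfolding k_def \<phi>x[OF x(2)] by (rule alg[OF ne(1) less_imp_neq[OF pos, symmetric]])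
      finally have "Im (\<rho> t) = k * (\<mu> t * \<phi> t)" .
      moreover have "k > 0" unfolding k_def using \<epsilon> ne pos by simp
      ultimately show ?thesis by blast
    qed
    have \<mu>pos: "0 < \<mu> t" if "t0 - \<delta> < t" "t < t0 + \<delta>" for t using \<delta>3(2)[of t] \<delta>(5) that by auto
    show False
    proof (rule no_logarithm_of_crossing[OF \<rho>c, of \<theta> t0 \<delta>])
      show "\<rho> (t + 2 * pi) = \<rho> t" for t
        by (simp add: \<rho>_def P_def Q_def C_def flip: cis_mult)
      show "\<rho> t \<noteq> 0" for t
      proof -
        obtain x where x: "norm x = 1" "f (cis t) = proj_pt x" using rep by blast
        show ?thesis using \<rho>x[OF x] by simp
      qed
      show "continuous_on UNIV \<theta>" unfolding \<theta>_def[abs_def]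
        by (intro continuous_intros continuous_on_sphere_cis \<eta>1 \<eta>2)
      show "\<theta> (t + 2 * pi) = \<theta> t" for t by (simp add: \<theta>_def flip: cis_mult)
      show "(\<rho> t)\<^sup>2 = of_real ((norm (\<rho> t))\<^sup>2) * cis (\<theta> t)" for t
      proof -
        obtain x where x: "norm x = 1" "f (cis t) = proj_pt x" using rep by blast
        have "(\<rho> t)\<^sup>2 = (perturbed g c \<epsilon> x)\<^sup>2 / (perturbed g c (- \<epsilon>) x)\<^sup>2"
          unfolding \<rho>x(1)[OF x] by (rule power_divide)
        also have "\<dots> = (of_real ((norm (perturbed g c \<epsilon> x))\<^sup>2) * cis (\<eta>1 (cis t)))
            / (of_real ((norm (perturbed g c (- \<epsilon>) x))\<^sup>2) * cis (\<eta>2 (cis t)))"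
          using \<eta>1(2)[rule_format, OF x] \<eta>2(2)[rule_format, OF x] by (simp only:)
        also have "\<dots> = of_real ((norm (\<rho> t))\<^sup>2) * (cis (\<eta>1 (cis t)) / cis (\<eta>2 (cis t)))"
          unfolding \<rho>x(1)[OF x] by (simp add: norm_divide power_divide)
        also have "cis (\<eta>1 (cis t)) / cis (\<eta>2 (cis t)) = cis (\<theta> t)" by (simp add: \<theta>_def cis_divide)
        finally show ?thesis .
      qed
      show "\<rho> t0 = -1"
        unfolding \<rho>x(1)[OF x0(2,1)] pert using \<epsilon> c0 by (simp add: z0x0 gx03)
      show "\<rho> t \<notin> \<real>\<^sub>\<le>\<^sub>0" if t: "t0 < t" "t < t0 + 2 * pi" for t
      proof
        assume "\<rho> t \<in> \<real>\<^sub>\<le>\<^sub>0"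
        then obtain k where k: "k \<ge> 0" "\<rho> t = - of_real k" by (auto elim!: nonpos_Reals_cases intro: that[of "- _"])
        obtain x where x: "norm x = 1" "f (cis t) = proj_pt x" using rep by blast
        have "perturbed g c \<epsilon> x = - of_real k * perturbed g c (- \<epsilon>) x"
          using \<rho>x[OF x] k(2) by (simp add: field_simps)
        \<comment> \<open>Dividing by \<open>1 + k\<close> exhibits a zero of the form with
          parameter \<open>(1 - k) / (1 + k) * \<epsilon>\<close>, whose size is at most
          \<open>\<epsilon>\<close>.\<close>
        then have "of_real (1 + k) * z0 x + of_real ((1 - k) * \<epsilon> * g x $ 3) * (\<i> * c) = 0"
          by (simp add: pert algebra_simps)
        then have "of_real (1 / (1 + k)) * (of_real (1 + k) * z0 x + of_real ((1 - k) * \<epsilon> * g x $ 3) * (\<i> * c)) = 0"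
          by simp
        moreover have "of_real (1 / (1 + k)) * (of_real (1 + k) * z0 x) = z0 x"
          using k(1) by (simp only: mult.assoc[symmetric] of_real_mult[symmetric]) simp
        ultimately have "z0 x + of_real ((1 - k) / (1 + k) * \<epsilon> * g x $ 3) * (\<i> * c) = 0"
          by (simp add: distrib_left mult.assoc)
        moreover have "\<bar>(1 - k) / (1 + k)\<bar> \<le> 1" using k(1) by (simp add: abs_le_iff divide_simps)
        ultimately have "cis t = cis t0" using away[OF x] by blast
        then show False using cis_neq_cis[of t t0] t by auto
      qed
      show "0 < \<delta>" by (rule \<delta>)
      show "0 < Im (\<rho> t)" if t: "t0 < t" "t < t0 + \<delta>" for t
      proof -
        obtain k where "k > 0" "Im (\<rho> t) = k * (\<mu> t * \<phi> t)" using imr[OF _ t(2)] t \<delta>(1) by auto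
        then show ?thesis using \<mu>pos[of t] \<phi>r[OF t] t \<delta>(1) by simp
      qed
      show "Im (\<rho> t) < 0" if t: "t0 - \<delta> < t" "t < t0" for t
      proof -
        obtain k where "k > 0" "Im (\<rho> t) = k * (\<mu> t * \<phi> t)" using imr[OF t(1)] t \<delta>(1) by auto
        then show ?thesis using \<mu>pos[of t] \<phi>l[OF t] t \<delta>(1) by (simp add: mult_pos_neg)
      qed
    qed
  qed
  then show thesis
  proof
    assume "?nolog \<epsilon>"
    then show thesis by (rule that[OF g(1,2), rotated]) (use nz[of \<epsilon>] in simp)
  next
    assume "?nolog (- \<epsilon>)"
    then show thesis by (rule that[OF g(1,2), rotated]) (use nz[of "- \<epsilon>"] in simp)
  qed
qed

section \<open>The companion\<close>

text \<open>The pushed form becomes \<open>u\<close>; shrinking the two remaining coordinates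
  enlarges the solid torus until it contains the knot.\<close>

lemma ex_torus_coordinates_without_logarithm:
  fixes f :: "complex \<Rightarrow> real^4^4"
  assumes f: "smooth_embedding (sphere 0 1) RP3 f"
  obtains M N where "M ** N = mat 1" "N ** M = mat 1"
    "\<forall>z\<in>sphere 0 1. \<forall>x. x \<noteq> 0 \<longrightarrow> f z = hpt x \<longrightarrow> ucoord N x \<noteq> 0 \<and> norm (vcoord N x) \<le> norm (ucoord N x)"
    "\<nexists>\<eta>. continuous_on (sphere 0 1) \<eta> \<and> (\<forall>z\<in>sphere 0 1. \<forall>x. x \<noteq> 0 \<longrightarrow> f z = hpt x \<longrightarrow>
       (ucoord N x)\<^sup>2 / of_real ((norm (ucoord N x))\<^sup>2) = cis (\<eta> z))"
proof -
  have sm: "smooth_on (sphere 0 1) f" and im: "f ` sphere 0 1 \<subseteq> RP3"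
    using f unfolding smooth_embedding_def diffeomorphism_def by simp_all
  obtain g c s where g: "linear g" "inj g"
    and nz': "\<forall>t x. norm x = 1 \<longrightarrow> f (cis t) = proj_pt x \<longrightarrow> perturbed g c s x \<noteq> 0"
    and nolog: "\<nexists>\<eta>. continuous_on (sphere (0::complex) 1) \<eta> \<and> (\<forall>t x. norm x = 1 \<longrightarrow> f (cis t) = proj_pt x \<longrightarrow>
       (perturbed g c s x)\<^sup>2 = of_real ((norm (perturbed g c s x))\<^sup>2) * cis (\<eta> (cis t)))"
    by (rule ex_perturbed_without_logarithm[OF f])
  note nz = nz'[rule_format]
  let ?p = "perturbed g c s"
  have plin: "linear ?p"
    by (rule linearI) (simp_all add: perturbed_def linear_add[OF g(1)] linear_cmul[OF g(1)] complex_eq_iff algebra_simps)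
  have pc: "continuous_on UNIV ?p" using plin by (simp add: linear_continuous_on linear_conv_bounded_linear)
  obtain B where B: "B > 0" "\<And>x. norm (g x) \<le> B * norm x" using linear_bounded_pos[OF g(1)] by blast
  define X where "X = {x. norm x = 1 \<and> proj_pt x \<in> f ` sphere 0 1}"
  have fcpt: "compact (f ` sphere 0 1)"
    by (intro compact_continuous_image smooth_on_imp_continuous_on[OF sm] compact_sphere)
  have cpp: "continuous_on UNIV proj_pt"
    unfolding proj_pt_def by (intro continuous_intros)
  have "closed (proj_pt -` (f ` sphere 0 1))"
    by (rule closed_vimage[OF compact_imp_closed[OF fcpt] cpp])
  then have "compact (sphere 0 1 \<inter> proj_pt -` (f ` sphere 0 1))"
    by (rule compact_Int_closed[OF compact_sphere])
  moreover have "sphere 0 1 \<inter> proj_pt -` (f ` sphere 0 1) = X" by (auto simp: X_def)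
  ultimately have Xc: "compact X" by simp
  have Xne: "X \<noteq> {}"
  proof -
    have "f 1 \<in> RP3" by (rule subsetD[OF im imageI]) simp
    then obtain x where "norm x = 1" "f 1 = proj_pt x" by (rule RP3_unit)
    moreover have "f 1 \<in> f ` sphere 0 1" by (rule imageI) simp
    ultimately have "x \<in> X" by (simp add: X_def)
    then show ?thesis by blast
  qed
  have "continuous_on X (\<lambda>x. norm (?p x))"
    by (intro continuous_on_norm continuous_on_subset[OF pc]) simp
  from continuous_attains_inf[OF Xc Xne this]
  obtain xm where xm: "xm \<in> X" "\<forall>x\<in>X. norm (?p xm) \<le> norm (?p x)" by (rule bexE)
  have Xcis: "\<exists>t. f (cis t) = proj_pt x" if "x \<in> X" for x
  proof -
    obtain z where z: "z \<in> sphere 0 1" "proj_pt x = f z" using \<open>x \<in> X\<close> unfolding X_def by blast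
    then have "z = cis (Arg z)" by (subst cis_Arg) (auto simp: sgn_div_norm)
    then show ?thesis using z(2) by metis
  qed
  define \<nu> where "\<nu> = norm (?p xm)"
  have \<nu>: "\<nu> > 0"
  proof -
    obtain t where "f (cis t) = proj_pt xm" using Xcis[OF xm(1)] by blast
    then show ?thesis using nz[of xm t] xm(1) by (simp add: \<nu>_def X_def)
  qed
  \<comment> \<open>On unit vectors over the knot this gives
    \<open>norm v \<le> \<delta> * B = \<nu> \<le> norm u\<close>.\<close>
  define \<delta> where "\<delta> = \<nu> / B"
  have \<delta>: "\<delta> > 0" using \<nu> B(1) by (simp add: \<delta>_def)
  define n :: "real^4 \<Rightarrow> real^4" where
    "n x = (\<chi> i. if i = 1 then Re (?p x) else if i = 2 then Im (?p x) else \<delta> * g x $ i)" for x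
  have n_nth: "n x $ 1 = Re (?p x)" "n x $ 2 = Im (?p x)" "n x $ 3 = \<delta> * g x $ 3" "n x $ 4 = \<delta> * g x $ 4" for x
    by (simp_all add: n_def)
  have nlin: "linear n"
    by (rule linearI) (simp_all add: vec4_eq_iff n_nth linear_add[OF plin] linear_cmul[OF plin] linear_add[OF g(1)]
        linear_cmul[OF g(1)] algebra_simps)
  \<comment> \<open>Triangular: the pushed form differs from the first two coordinates of
    \<open>g x\<close> by a multiple of the third.\<close>
  have "x = 0" if "n x = 0" for x
  proof -
    have "Re (?p x) = 0" "Im (?p x) = 0" "g x $ 3 = 0" "g x $ 4 = 0"
      using n_nth[of x] \<delta> unfolding that by simp_all
    then have "g x = 0" by (simp add: vec4_eq_iff perturbed_def)
    then show "x = 0" using linear_injective_0[OF g(1)] g(2) by blast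
  qed
  then have ninj: "inj n" using linear_injective_0[OF nlin] by blast
  define N where "N = matrix n"
  have Nx: "N *v x = n x" for x
    using matrix_works[of n x] nlin by (simp add: N_def linear_matrix_vector_mul_eq)
  have "inj ((*v) N)" using ninj by (simp add: Nx inj_def)
  then obtain M where M: "M ** N = mat 1" using matrix_left_invertible_injective by blast
  then have M': "N ** M = mat 1" by (simp add: matrix_left_right_inverse)
  have u: "ucoord N x = ?p x" for x by (simp add: ucoord_def Nx n_nth)
  have v: "vcoord N x = of_real \<delta> * Complex (g x $ 3) (g x $ 4)" for x
    by (simp add: vcoord_def Nx n_nth complex_eq_iff)
  have unit: "\<exists>y. norm y = 1 \<and> proj_pt y = hpt x \<and> x = norm x *\<^sub>R y" if "x \<noteq> 0" for x
  proof (intro exI conjI)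
    show "norm (sgn x) = 1" using that by (simp add: norm_sgn)
    show "proj_pt (sgn x) = hpt x"
      using hpt_unit[of "sgn x"] hpt_scaleR[of "inverse (norm x)" x] that by (simp add: norm_sgn sgn_div_norm)
    show "x = norm x *\<^sub>R sgn x" using that by (simp add: sgn_div_norm)
  qed
  show thesis
  proof (rule that[OF M M'])
    show "\<forall>z\<in>sphere 0 1. \<forall>x. x \<noteq> 0 \<longrightarrow> f z = hpt x \<longrightarrow> ucoord N x \<noteq> 0 \<and> norm (vcoord N x) \<le> norm (ucoord N x)"
    proof (intro ballI allI impI)
      fix z x assume z: "z \<in> sphere 0 1" and x: "x \<noteq> 0" "f z = hpt x"
      obtain y where y: "norm y = 1" "proj_pt y = hpt x" "x = norm x *\<^sub>R y" using unit[OF x(1)] by blast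
      have "proj_pt y \<in> f ` sphere 0 1" unfolding y(2) x(2)[symmetric] using z by (rule imageI)
      then have "y \<in> X" using y(1) by (simp add: X_def)
      then have py: "\<nu> \<le> norm (?p y)" using xm(2) by (simp add: \<nu>_def)
      have "norm (?p x) = norm x * norm (?p y)" by (subst y(3)) (simp add: linear_cmul[OF plin])
      then have 1: "norm x * \<nu> \<le> norm (?p x)" using py by (simp add: mult_left_mono)
      have "norm x * \<nu> > 0" using x(1) \<nu> by simp
      with 1 have p0: "?p x \<noteq> 0" by auto
      have "norm (Complex (g x $ 3) (g x $ 4)) \<le> norm (g x)"
        unfolding complex_norm complex.sel norm_vec_def L2_set_def sum_4 by (rule real_sqrt_le_mono) simp
      then have "\<delta> * norm (Complex (g x $ 3) (g x $ 4)) \<le> \<delta> * (B * norm x)"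
        using B(2)[of x] \<delta> by (intro mult_left_mono) auto
      moreover have "norm (vcoord N x) = \<delta> * norm (Complex (g x $ 3) (g x $ 4))"
        using \<delta> unfolding v norm_mult by simp
      moreover have "\<delta> * (B * norm x) = norm x * \<nu>" using B(1) by (simp add: \<delta>_def)
      ultimately have v\<nu>: "norm (vcoord N x) \<le> norm x * \<nu>" by simp
      show "ucoord N x \<noteq> 0 \<and> norm (vcoord N x) \<le> norm (ucoord N x)"
        using 1 v\<nu> p0 by (simp add: u)
    qed
    show "\<nexists>\<eta>. continuous_on (sphere 0 1) \<eta> \<and> (\<forall>z\<in>sphere 0 1. \<forall>x. x \<noteq> 0 \<longrightarrow> f z = hpt x \<longrightarrow>
       (ucoord N x)\<^sup>2 / of_real ((norm (ucoord N x))\<^sup>2) = cis (\<eta> z))"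
    proof (rule notI, elim exE conjE)
      fix \<eta> assume \<eta>: "continuous_on (sphere 0 1) \<eta>" "\<forall>z\<in>sphere 0 1. \<forall>x. x \<noteq> 0 \<longrightarrow> f z = hpt x \<longrightarrow>
       (ucoord N x)\<^sup>2 / of_real ((norm (ucoord N x))\<^sup>2) = cis (\<eta> z)"
      have "(?p x)\<^sup>2 = of_real ((norm (?p x))\<^sup>2) * cis (\<eta> (cis t))" if x: "norm x = 1" "f (cis t) = proj_pt x" for t x
      proof -
        have "x \<noteq> 0" "f (cis t) = hpt x" using x hpt_unit[OF x(1)] by auto
        then have "(?p x)\<^sup>2 / of_real ((norm (?p x))\<^sup>2) = cis (\<eta> (cis t))" using \<eta>(2) by (simp add: u)
        moreover have "?p x \<noteq> 0" by (rule nz[OF x])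
        ultimately show ?thesis by (simp add: field_simps)
      qed
      with \<eta>(1) nolog show False by blast
    qed
  qed
qed

theorem theorem5p1:
  fixes U K :: "(real^4^4) set"
  assumes "U \<in> projective_unknot" and "knot K"
  shows "companion U K"
proof -
  obtain f :: "complex \<Rightarrow> real^4^4" where f: "smooth_embedding (sphere 0 1) RP3 f" and K: "K = f ` sphere 0 1"
    using assms(2) unfolding knot_def by (elim exE conjE)
  obtain L where L: "projective_line L" "ambient_isotopic L U"
    using assms(1) unfolding projective_unknot_def mem_Collect_eq by (elim exE conjE)
  have LR: "L \<subseteq> RP3" using L(1) unfolding projective_line_def RP3_def by blast
  obtain M N where MN: "M ** N = mat 1" "N ** M = mat 1"
    and KV: "\<forall>z\<in>sphere 0 1. \<forall>x. x \<noteq> 0 \<longrightarrow> f z = hpt x \<longrightarrow> ucoord N x \<noteq> 0 \<and> norm (vcoord N x) \<le> norm (ucoord N x)"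
    and nolog: "\<nexists>\<eta>. continuous_on (sphere 0 1) \<eta> \<and> (\<forall>z\<in>sphere 0 1. \<forall>x. x \<noteq> 0 \<longrightarrow> f z = hpt x \<longrightarrow>
       (ucoord N x)\<^sup>2 / of_real ((norm (ucoord N x))\<^sup>2) = cis (\<eta> z))"
    by (rule ex_torus_coordinates_without_logarithm[OF f])
  let ?V = "torus_nbhd N" and ?c = "torus_chart M ` (sphere 0 1 \<times> {0})"
  note fr = framing_torus_chart[OF MN]
  have fR: "f z \<in> RP3" if "z \<in> sphere 0 1" for z
    using f that unfolding smooth_embedding_def by blast
  have fV: "f ` sphere 0 1 \<subseteq> ?V"
  proof (rule image_subsetI)
    fix z :: complex assume z: "z \<in> sphere 0 1"
    obtain x where x: "x \<noteq> 0" "f z = hpt x" using fR[OF z] unfolding RP3_hpt by blast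
    show "f z \<in> ?V" unfolding torus_nbhd_def x(2) using KV z x by (intro imageI CollectI) simp
  qed
  have fc: "continuous_on (sphere 0 1) f"
    using f unfolding smooth_embedding_def diffeomorphism_def by (intro smooth_on_imp_continuous_on) simp
  \<comment> \<open>The circle coordinate of the knot in this framing is \<open>u\<^sup>2\<close>
    divided by its norm, which by construction has no continuous argument.\<close>
  have inv: "inv_into std_solid_torus (torus_chart M) (f z) =
      ((ucoord N x)\<^sup>2 / of_real ((norm (ucoord N x))\<^sup>2), vcoord N x / ucoord N x)"
    if z: "z \<in> sphere 0 1" and x: "x \<noteq> 0" "f z = hpt x" for z x
  proof -
    have uv: "ucoord N x \<noteq> 0" "norm (vcoord N x) \<le> norm (ucoord N x)" using KV z x by blast+
    have "((ucoord N x)\<^sup>2 / of_real ((norm (ucoord N x))\<^sup>2), vcoord N x / ucoord N x) \<in> std_solid_torus"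
      using uv by (simp add: std_solid_torus_def norm_divide norm_power)
    from framing_facts(5)[OF fr this] show ?thesis
      unfolding torus_chart_coords[OF MN uv(1)] x(2) .
  qed
  have "geometrically_essential ?V (f ` sphere 0 1)"
  proof (rule geometrically_essential_if_no_logarithm[OF fr fc fV], rule notI, elim exE conjE)
    fix \<eta> assume \<eta>: "continuous_on (sphere 0 1) \<eta>"
      "\<forall>z\<in>sphere 0 1. fst (inv_into std_solid_torus (torus_chart M) (f z)) = cis (\<eta> z)"
    have "\<forall>z\<in>sphere 0 1. \<forall>x. x \<noteq> 0 \<longrightarrow> f z = hpt x \<longrightarrow>
       (ucoord N x)\<^sup>2 / of_real ((norm (ucoord N x))\<^sup>2) = cis (\<eta> z)"
      using \<eta>(2) inv by (metis fst_conv)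
    with \<eta>(1) nolog show False by blast
  qed
  moreover have "ambient_isotopic U ?c"
    using ambient_isotopic_trans[OF ambient_isotopic_sym[OF L(2) LR]
        projective_lines_isotopic[OF L(1) projective_line_core[OF MN]]] .
  moreover have "tubular_neighborhood ?V ?c" unfolding tubular_neighborhood_def using fr by blast
  ultimately show ?thesis
    unfolding companion_def using fV ambient_isotopic_refl K by (intro exI[of _ ?c] exI[of _ K] exI[of _ ?V]) simp
qed

end
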